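(* Let $T$ be an additive ternary $\Gamma$-ring with unital regular representation $\widehat\rho_T$, unital regular defect $K=\ker\widehat\rho_T$ and conormal operator defect $\mathcal C(T,\Gamma)=K/K^2$. If $K$ is nilpotent (that is, $K^N=0$ for some $N\ge1$), then the following are equivalent: (i) $\mathcal C(T,\Gamma)=0$; (ii) $K=0$; (iii) the unital regular representation $\widehat\rho_T$ is faithful (injective). Thus, if $K$ is nilpotent and nonzero, then $\operatorname{Tor}^{\mathcal A(T,\Gamma)}_1(\mathcal R_T,\mathcal R_T)\ne0$.
   Context: An additive ternary $\Gamma$-ring consists of abelian groups $(T,+)$, $(\Gamma,+)$ and a map $T\times\Gamma\times T\times\Gamma\times T\to T$, $(x,\alpha,y,\beta,z)\mapsto x\alpha y\beta z$, additive in each of the five variables, with $(x\alpha y\beta z)\gamma u\delta v=x\alpha(y\beta z\gamma u)\delta v=x\alpha y\beta(z\gamma u\delta v)$. Let $F(T,\Gamma)=T\otimes_{\mathbb Z}\Gamma\otimes_{\mathbb Z}T\otimes_{\mathbb Z}\Gamma$ with the associative bilinear multiplication $(a\otimes\alpha\otimes b\otimes\beta)(c\otimes\gamma\otimes d\otimes\delta)=(a\alpha b\beta c)\otimes\gamma\otimes d\otimes\delta$, let $J(T,\Gamma)$ be the two-sided ideal generated by all $(a\alpha b\beta c)\otimes\gamma\otimes d\otimes\delta-a\otimes\alpha\otimes(b\beta c\gamma d)\otimes\delta$, and let $\mathcal O(T,\Gamma)=F(T,\Gamma)/J(T,\Gamma)$; $[a,\alpha,b,\beta]$ is the class of a pure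 tensor. The unital ring $\mathcal A(T,\Gamma)=\mathbb Z\ltimes\mathcal O(T,\Gamma)$ is $\mathbb Z\oplus\mathcal O(T,\Gamma)$ with $(n,r)(m,s)=(nm,ns+mr+rs)$. The regular representation is $\rho_T:\mathcal O(T,\Gamma)\to\operatorname{End}_{\mathbb Z}(T)$, $\rho_T([a,\alpha,b,\beta])(x)=a\alpha b\beta x$, and its unital extension (the unital regular representation) is $\widehat\rho_T:\mathcal A(T,\Gamma)\to\operatorname{End}_{\mathbb Z}(T)$, $\widehat\rho_T(n,u)=n\operatorname{id}_T+\rho_T(u)$. The regular operator ring is $\mathcal R_T=\operatorname{im}\widehat\rho_T\cong\mathcal A(T,\Gamma)/K$, regarded as a left and right $\mathcal A(T,\Gamma)$-module through the quotient map. *)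

theory Defs
  imports "HOL-Algebra.Algebra" "HOL-Library.Function_Algebras"
begin

section \<open>Tensor products of abelian groups\<close>

definition tensor_relations ::
    "(('a::ab_group_add \<times> 'b::ab_group_add) \<Rightarrow>\<^sub>0 int) set" where
  "tensor_relations =
     {frag_of (a + a', b) - frag_of (a, b) - frag_of (a', b) | a a' b. True} \<union>
     {frag_of (a, b + b') - frag_of (a, b) - frag_of (a, b') | a b b'. True}"

definition tensor_null ::
    "(('a::ab_group_add \<times> 'b::ab_group_add) \<Rightarrow>\<^sub>0 int) set" where
  "tensor_null = generate (free_Abelian_group UNIV) tensor_relations"

lemma tensor_null_subgroup: "subgroup tensor_null (free_Abelian_group UNIV)"
  unfolding tensor_null_def
  by (rule group.generate_is_subgroup) auto

lemma tensor_null_0: "0 \<in> tensor_null"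
  using subgroup.one_closed[OF tensor_null_subgroup] by simp

lemma tensor_null_add: "x \<in> tensor_null \<Longrightarrow> y \<in> tensor_null \<Longrightarrow> x + y \<in> tensor_null"
  using subgroup.m_closed[OF tensor_null_subgroup] by simp

lemma tensor_null_uminus: "x \<in> tensor_null \<Longrightarrow> - x \<in> tensor_null"
  using subgroup.m_inv_closed[OF tensor_null_subgroup] by simp

lemma tensor_null_diff: "x \<in> tensor_null \<Longrightarrow> y \<in> tensor_null \<Longrightarrow> x - y \<in> tensor_null"
  using tensor_null_add[OF _ tensor_null_uminus] by fastforce

definition tensor_eq ::
    "(('a::ab_group_add \<times> 'b::ab_group_add) \<Rightarrow>\<^sub>0 int) \<Rightarrow> (('a \<times> 'b) \<Rightarrow>\<^sub>0 int) \<Rightarrow> bool" where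
  "tensor_eq x y \<longleftrightarrow> x - y \<in> tensor_null"

text \<open>The type \<open>('a, 'b) tensor\<close> is the tensor product of \<open>'a\<close> and \<open>'b\<close> over the integers.\<close>

quotient_type (overloaded) ('a, 'b) tensor =
  "('a::ab_group_add \<times> 'b::ab_group_add) \<Rightarrow>\<^sub>0 int" / tensor_eq
proof (rule equivpI)
  show "reflp tensor_eq"
    by (auto simp: reflp_def tensor_eq_def tensor_null_0)
  show "symp tensor_eq"
    unfolding symp_def tensor_eq_def using tensor_null_uminus by fastforce
  show "transp tensor_eq"
    unfolding transp_def tensor_eq_def using tensor_null_add by fastforce
qed

instantiation tensor :: (ab_group_add, ab_group_add) ab_group_add
begin

lift_definition zero_tensor :: "('a, 'b) tensor" is 0 .

lift_definition plus_tensor :: "('a, 'b) tensor \<Rightarrow> ('a, 'b) tensor \<Rightarrow> ('a, 'b) tensor" is "(+)"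
  unfolding tensor_eq_def by (drule (1) tensor_null_add) (simp add: algebra_simps)

lift_definition uminus_tensor :: "('a, 'b) tensor \<Rightarrow> ('a, 'b) tensor" is uminus
  unfolding tensor_eq_def by (drule tensor_null_uminus) (simp add: algebra_simps)

lift_definition minus_tensor :: "('a, 'b) tensor \<Rightarrow> ('a, 'b) tensor \<Rightarrow> ('a, 'b) tensor" is "(-)"
  unfolding tensor_eq_def by (drule (1) tensor_null_diff) (simp add: algebra_simps)

instance
  by standard (transfer, simp add: tensor_eq_def tensor_null_0 algebra_simps)+

end

lift_definition tns :: "'a::ab_group_add \<Rightarrow> 'b::ab_group_add \<Rightarrow> ('a, 'b) tensor"
  is "\<lambda>a b. frag_of (a, b)" .

text \<open>The additive map on the tensor product induced by a biadditive map.\<close>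

definition tensor_lift ::
    "('a::ab_group_add \<Rightarrow> 'b::ab_group_add \<Rightarrow> 'c::ab_group_add) \<Rightarrow> ('a, 'b) tensor \<Rightarrow> 'c" where
  "tensor_lift f = (THE h. Modules.additive h \<and> (\<forall>a b. h (tns a b) = f a b))"

lemma tns_add_left: "tns (a + a') b = tns a b + tns a' b"
proof (transfer, unfold tensor_eq_def)
  fix a a' :: 'a and b :: 'b
  have "frag_of (a + a', b) - frag_of (a, b) - frag_of (a', b) \<in> tensor_null"
    unfolding tensor_null_def by (rule generate.incl) (auto simp: tensor_relations_def)
  then show "frag_of (a + a', b) - (frag_of (a, b) + frag_of (a', b)) \<in> tensor_null"
    by (simp add: diff_diff_eq)
qed

lemma tns_add_right: "tns a (b + b') = tns a b + tns a b'"
proof (transfer, unfold tensor_eq_def)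
  fix a :: 'a and b b' :: 'b
  have "frag_of (a, b + b') - frag_of (a, b) - frag_of (a, b') \<in> tensor_null"
    unfolding tensor_null_def by (rule generate.incl) (unfold tensor_relations_def, blast)
  then show "frag_of (a, b + b') - (frag_of (a, b) + frag_of (a, b')) \<in> tensor_null"
    by (simp add: diff_diff_eq)
qed

lemma tensor_induct [case_names zero tns diff]:
  fixes x :: "('a::ab_group_add, 'b::ab_group_add) tensor"
  assumes zero: "P 0" and tns: "\<And>a b. P (tns a b)"
    and diff: "\<And>x y. P x \<Longrightarrow> P y \<Longrightarrow> P (x - y)"
  shows "P x"
proof -
  have "P (abs_tensor c)" for c :: "('a \<times> 'b) \<Rightarrow>\<^sub>0 int"
  proof (rule frag_induction[where S = UNIV and P = "\<lambda>c. P (abs_tensor c)"])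
    show "P (abs_tensor 0)" using zero by (simp add: zero_tensor_def)
    show "P (abs_tensor (frag_of p))" for p :: "'a \<times> 'b"
      using tns[of "fst p" "snd p"] by (simp add: tns.abs_eq)
    show "P (abs_tensor (c - d))" if "P (abs_tensor c)" "P (abs_tensor d)"
      for c d :: "('a \<times> 'b) \<Rightarrow>\<^sub>0 int"
      using diff[OF that] by (simp add: minus_tensor.abs_eq)
  qed simp
  then show ?thesis
    by (metis Quotient3_abs_rep[OF Quotient3_tensor])
qed

lemma tensor_lift_ex1:
  fixes f :: "'a::ab_group_add \<Rightarrow> 'b::ab_group_add \<Rightarrow> 'c::ab_group_add"
  assumes l: "\<And>a a' b. f (a + a') b = f a b + f a' b"
    and r: "\<And>a b b'. f a (b + b') = f a b + f a b'"
  shows "\<exists>!h. Modules.additive h \<and> (\<forall>a b. h (tns a b) = f a b)"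
proof (rule ex_ex1I)
  define G :: "'c monoid" where "G = \<lparr>carrier = UNIV, monoid.mult = (+), one = 0\<rparr>"
  interpret G: comm_group G
    by (rule comm_groupI) (auto simp: G_def algebra_simps intro: exI[of _ "- _"])
  obtain h where h: "h \<in> hom (free_Abelian_group UNIV) G"
    and hf: "\<And>p. h (frag_of p) = case_prod f p"
    using G.free_Abelian_group_universal[of "case_prod f" UNIV] by (auto simp: G_def)
  have h_add: "h (x + y) = h x + h y" for x y
    using h by (auto simp: hom_def G_def free_Abelian_group_def)
  then interpret h: Modules.additive h by unfold_locales
  have ker: "h x = 0" if "x \<in> tensor_null" for x
    using that unfolding tensor_null_def
  proof (induction rule: generate.induct)
    case one
    then show ?case by (simp add: h.zero)
  next
    case (incl c)
    then show ?case by (auto simp: tensor_relations_def h.diff hf l r)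
  next
    case (inv c)
    then show ?case by (auto simp: tensor_relations_def h.diff h.minus hf l r)
  next
    case (eng c d)
    then show ?case by (simp add: h_add)
  qed
  have resp: "h x = h y" if "tensor_eq x y" for x y
    using ker[of "x - y"] that by (simp add: tensor_eq_def h.diff)
  define k where "k x = h (rep_tensor x)" for x
  have k_abs: "k (abs_tensor c) = h c" for c
    unfolding k_def
    by (rule resp) (meson Quotient3_tensor rep_abs_rsp_left Quotient3_rep_abs
        tensor_equivp equivp_reflp)
  have "k (x + y) = k x + k y" for x y
    by (metis Quotient3_abs_rep[OF Quotient3_tensor] plus_tensor.abs_eq k_abs h_add)
  then have "Modules.additive k" by unfold_locales
  moreover have "k (tns a b) = f a b" for a b
    by (simp add: tns.abs_eq k_abs hf)
  ultimately show "\<exists>h. Modules.additive h \<and> (\<forall>a b. h (tns a b) = f a b)" by blast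
next
  fix h k :: "('a, 'b) tensor \<Rightarrow> 'c"
  assume h: "Modules.additive h \<and> (\<forall>a b. h (tns a b) = f a b)"
    and k: "Modules.additive k \<and> (\<forall>a b. k (tns a b) = f a b)"
  interpret h: Modules.additive h using h by simp
  interpret k: Modules.additive k using k by simp
  show "h = k"
  proof
    fix x show "h x = k x"
      by (induction x rule: tensor_induct) (use h k in \<open>auto simp: h.zero k.zero h.diff k.diff\<close>)
  qed
qed

lemma tensor_lift:
  assumes "\<And>a a' b. f (a + a') b = f a b + f a' b"
    and "\<And>a b b'. f a (b + b') = f a b + f a b'"
  shows "Modules.additive (tensor_lift f)" "tensor_lift f (tns a b) = f a b"
  using theI'[OF tensor_lift_ex1[OF assms]] by (auto simp: tensor_lift_def)

definition tns4 :: "'a::ab_group_add \<Rightarrow> 'b::ab_group_add \<Rightarrow> 'c::ab_group_add \<Rightarrow> 'd::ab_group_add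
    \<Rightarrow> ((('a, 'b) tensor, 'c) tensor, 'd) tensor" where
  "tns4 a b c d = tns (tns (tns a b) c) d"

definition tensor4_lift ::
    "('a::ab_group_add \<Rightarrow> 'b::ab_group_add \<Rightarrow> 'c::ab_group_add \<Rightarrow> 'd::ab_group_add
       \<Rightarrow> 'e::ab_group_add)
     \<Rightarrow> ((('a, 'b) tensor, 'c) tensor, 'd) tensor \<Rightarrow> 'e" where
  "tensor4_lift f =
     tensor_lift (\<lambda>u d. tensor_lift (\<lambda>v c. tensor_lift (\<lambda>a b. f a b c d) v) u)"


section \<open>Additive ternary Gamma-rings\<close>

locale ternary_gamma_ring =
  fixes tern :: "'t::ab_group_add \<Rightarrow> 'g::ab_group_add \<Rightarrow> 't \<Rightarrow> 'g \<Rightarrow> 't \<Rightarrow> 't"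
  assumes additive1: "Modules.additive (\<lambda>x. tern x \<alpha> y \<beta> z)"
    and additive2: "Modules.additive (\<lambda>\<alpha>. tern x \<alpha> y \<beta> z)"
    and additive3: "Modules.additive (\<lambda>y. tern x \<alpha> y \<beta> z)"
    and additive4: "Modules.additive (\<lambda>\<beta>. tern x \<alpha> y \<beta> z)"
    and additive5: "Modules.additive (\<lambda>z. tern x \<alpha> y \<beta> z)"
    and assoc_left: "tern (tern x \<alpha> y \<beta> z) \<gamma> u \<delta> v = tern x \<alpha> (tern y \<beta> z \<gamma> u) \<delta> v"
    and assoc_right: "tern x \<alpha> (tern y \<beta> z \<gamma> u) \<delta> v = tern x \<alpha> y \<beta> (tern z \<gamma> u \<delta> v)"

type_synonym ('t, 'g) F = "((('t, 'g) tensor, 't) tensor, 'g) tensor"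

definition F_mult :: "('t::ab_group_add \<Rightarrow> 'g::ab_group_add \<Rightarrow> 't \<Rightarrow> 'g \<Rightarrow> 't \<Rightarrow> 't)
    \<Rightarrow> ('t, 'g) F \<Rightarrow> ('t, 'g) F \<Rightarrow> ('t, 'g) F" where
  "F_mult tern =
     tensor4_lift (\<lambda>a \<alpha> b \<beta>. tensor4_lift (\<lambda>c \<gamma> d \<delta>. tns4 (tern a \<alpha> b \<beta> c) \<gamma> d \<delta>))"

text \<open>
  \<open>F\<close> and its quotient \<open>O\<close> are rings without unit; the \<open>one\<close> fields of their records
  carry no meaning and are never used.
\<close>

definition F_ring :: "('t::ab_group_add \<Rightarrow> 'g::ab_group_add \<Rightarrow> 't \<Rightarrow> 'g \<Rightarrow> 't \<Rightarrow> 't)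
    \<Rightarrow> ('t, 'g) F ring" where
  "F_ring tern =
     \<lparr>carrier = UNIV, monoid.mult = F_mult tern, one = undefined, ring.zero = 0, ring.add = (+)\<rparr>"

text \<open>
  Two-sided ideals of a ring not assumed unital (the library's \<^const>\<open>ideal\<close> and
  \<^const>\<open>genideal\<close> require a unit).
\<close>

definition rng_ideal :: "('a, 'm) ring_scheme \<Rightarrow> 'a set \<Rightarrow> bool" where
  "rng_ideal R I \<longleftrightarrow> subgroup I (add_monoid R) \<and>
     (\<forall>x\<in>carrier R. \<forall>i\<in>I. x \<otimes>\<^bsub>R\<^esub> i \<in> I \<and> i \<otimes>\<^bsub>R\<^esub> x \<in> I)"

definition rng_genideal :: "('a, 'm) ring_scheme \<Rightarrow> 'a set \<Rightarrow> 'a set" where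
  "rng_genideal R S = \<Inter>{I. rng_ideal R I \<and> S \<subseteq> I}"

definition J_ideal :: "('t::ab_group_add \<Rightarrow> 'g::ab_group_add \<Rightarrow> 't \<Rightarrow> 'g \<Rightarrow> 't \<Rightarrow> 't)
    \<Rightarrow> ('t, 'g) F set" where
  "J_ideal tern = rng_genideal (F_ring tern)
     {tns4 (tern a \<alpha> b \<beta> c) \<gamma> d \<delta> - tns4 a \<alpha> (tern b \<beta> c \<gamma> d) \<delta> | a \<alpha> b \<beta> c \<gamma> d \<delta>. True}"

definition O_ring :: "('t::ab_group_add \<Rightarrow> 'g::ab_group_add \<Rightarrow> 't \<Rightarrow> 'g \<Rightarrow> 't \<Rightarrow> 't)
    \<Rightarrow> ('t, 'g) F set ring" where
  "O_ring tern = F_ring tern Quot J_ideal tern"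

definition A_ring :: "('t::ab_group_add \<Rightarrow> 'g::ab_group_add \<Rightarrow> 't \<Rightarrow> 'g \<Rightarrow> 't \<Rightarrow> 't)
    \<Rightarrow> (int \<times> ('t, 'g) F set) ring" where
  "A_ring tern = (let R = O_ring tern in
     \<lparr>carrier = UNIV \<times> carrier R,
      monoid.mult = \<lambda>(n, r) (m, s). (n * m, ([n] \<cdot>\<^bsub>R\<^esub> s \<oplus>\<^bsub>R\<^esub> [m] \<cdot>\<^bsub>R\<^esub> r) \<oplus>\<^bsub>R\<^esub> r \<otimes>\<^bsub>R\<^esub> s),
      one = (1, \<zero>\<^bsub>R\<^esub>),
      ring.zero = (0, \<zero>\<^bsub>R\<^esub>),
      ring.add = \<lambda>(n, r) (m, s). (n + m, r \<oplus>\<^bsub>R\<^esub> s)\<rparr>)"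


section \<open>The regular representation and its defect\<close>

definition End_ring :: "('t::ab_group_add \<Rightarrow> 't) ring" where
  "End_ring =
     \<lparr>carrier = {f. Modules.additive f}, monoid.mult = (\<circ>), one = id,
      ring.zero = (\<lambda>_. 0), ring.add = (\<lambda>f g x. f x + g x)\<rparr>"

text \<open>
  \<open>rho\<close> is the map induced on cosets of \<open>J\<close> by the additive map on \<open>F\<close>
  sending a pure tensor to the left multiplication operator it defines.
\<close>

definition rho :: "('t::ab_group_add \<Rightarrow> 'g::ab_group_add \<Rightarrow> 't \<Rightarrow> 'g \<Rightarrow> 't \<Rightarrow> 't)
    \<Rightarrow> ('t, 'g) F set \<Rightarrow> 't \<Rightarrow> 't" where
  "rho tern U = the_elem (tensor4_lift (\<lambda>a \<alpha> b \<beta>. \<lambda>x. tern a \<alpha> b \<beta> x) ` U)"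

definition rho_hat :: "('t::ab_group_add \<Rightarrow> 'g::ab_group_add \<Rightarrow> 't \<Rightarrow> 'g \<Rightarrow> 't \<Rightarrow> 't)
    \<Rightarrow> int \<times> ('t, 'g) F set \<Rightarrow> 't \<Rightarrow> 't" where
  "rho_hat tern = (\<lambda>(n, u). [n] \<cdot>\<^bsub>End_ring\<^esub> id \<oplus>\<^bsub>End_ring\<^esub> rho tern u)"

definition defect :: "('t::ab_group_add \<Rightarrow> 'g::ab_group_add \<Rightarrow> 't \<Rightarrow> 'g \<Rightarrow> 't \<Rightarrow> 't)
    \<Rightarrow> (int \<times> ('t, 'g) F set) set" where
  "defect tern = a_kernel (A_ring tern) End_ring (rho_hat tern)"

primrec ideal_power :: "('a, 'm) ring_scheme \<Rightarrow> 'a set \<Rightarrow> nat \<Rightarrow> 'a set" where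
  "ideal_power R I 0 = carrier R"
| "ideal_power R I (Suc n) = ideal_power R I n \<cdot>\<^bsub>R\<^esub> I"

definition nilpotent_ideal :: "('a, 'm) ring_scheme \<Rightarrow> 'a set \<Rightarrow> bool" where
  "nilpotent_ideal R I \<longleftrightarrow> (\<exists>N\<ge>1. ideal_power R I N = {\<zero>\<^bsub>R\<^esub>})"

definition conormal_defect :: "('t::ab_group_add \<Rightarrow> 'g::ab_group_add \<Rightarrow> 't \<Rightarrow> 'g \<Rightarrow> 't \<Rightarrow> 't)
    \<Rightarrow> (int \<times> ('t, 'g) F set) set monoid" where
  "conormal_defect tern =
     (add_monoid (A_ring tern))\<lparr>carrier := defect tern\<rparr>
       Mod ideal_power (A_ring tern) (defect tern) 2"


section \<open>The first Tor group over a ring\<close>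

text \<open>
  The record \<^typ>\<open>('a, 'b) module\<close> holds left as well as right modules over a ring that need
  not be commutative. For a right module, \<open>a \<odot>\<^bsub>M\<^esub> m\<close> stands for \<open>m\<close> acted on by
  \<open>a\<close> from the right. The \<open>mult\<close> and \<open>one\<close> fields are not used.
\<close>

definition balanced_relations ::
    "('a, 'k) ring_scheme \<Rightarrow> ('a, 'm, 'k1) module_scheme \<Rightarrow> ('a, 'n, 'k2) module_scheme
     \<Rightarrow> (('m \<times> 'n) \<Rightarrow>\<^sub>0 int) set" where
  "balanced_relations A M N =
     {frag_of (x \<oplus>\<^bsub>M\<^esub> x', y) - frag_of (x, y) - frag_of (x', y) | x x' y.
        x \<in> carrier M \<and> x' \<in> carrier M \<and> y \<in> carrier N} \<union>
     {frag_of (x, y \<oplus>\<^bsub>N\<^esub> y') - frag_of (x, y) - frag_of (x, y') | x y y'.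
        x \<in> carrier M \<and> y \<in> carrier N \<and> y' \<in> carrier N} \<union>
     {frag_of (a \<odot>\<^bsub>M\<^esub> x, y) - frag_of (x, a \<odot>\<^bsub>N\<^esub> y) | a x y.
        a \<in> carrier A \<and> x \<in> carrier M \<and> y \<in> carrier N}"

definition balanced_null ::
    "('a, 'k) ring_scheme \<Rightarrow> ('a, 'm, 'k1) module_scheme \<Rightarrow> ('a, 'n, 'k2) module_scheme
     \<Rightarrow> (('m \<times> 'n) \<Rightarrow>\<^sub>0 int) set" where
  "balanced_null A M N =
     generate (free_Abelian_group (carrier M \<times> carrier N)) (balanced_relations A M N)"

text \<open>The tensor product over \<open>A\<close> of a right module \<open>M\<close> and a left module \<open>N\<close>.\<close>

definition tensor_prod ::
    "('a, 'k) ring_scheme \<Rightarrow> ('a, 'm, 'k1) module_scheme \<Rightarrow> ('a, 'n, 'k2) module_scheme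
     \<Rightarrow> (('m \<times> 'n) \<Rightarrow>\<^sub>0 int) set monoid" where
  "tensor_prod A M N =
     free_Abelian_group (carrier M \<times> carrier N) Mod balanced_null A M N"

text \<open>
  The map from \<open>tensor_prod A M N\<close> to \<open>tensor_prod A M' N\<close> induced by a homomorphism
  \<open>f\<close> of right modules.
\<close>

definition tensor_map ::
    "('a, 'k) ring_scheme \<Rightarrow> ('a, 'm', 'k1) module_scheme \<Rightarrow> ('a, 'n, 'k2) module_scheme
     \<Rightarrow> ('m \<Rightarrow> 'm') \<Rightarrow> (('m \<times> 'n) \<Rightarrow>\<^sub>0 int) set \<Rightarrow> (('m' \<times> 'n) \<Rightarrow>\<^sub>0 int) set" where
  "tensor_map A M' N f U =
     (\<Union>c\<in>U. balanced_null A M' N #>\<^bsub>free_Abelian_group (carrier M' \<times> carrier N)\<^esub>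
        frag_extend (\<lambda>(x, y). frag_of (f x, y)) c)"

text \<open>The free right module on a set, realised by finitely supported functions.\<close>

definition free_right_module ::
    "('a, 'k) ring_scheme \<Rightarrow> 'x set \<Rightarrow> ('a, 'x \<Rightarrow> 'a) module" where
  "free_right_module A U =
     \<lparr>carrier = {c. (\<forall>x. c x \<in> carrier A) \<and> {x. c x \<noteq> \<zero>\<^bsub>A\<^esub>} \<subseteq> U \<and> finite {x. c x \<noteq> \<zero>\<^bsub>A\<^esub>}},
      monoid.mult = undefined, one = undefined,
      ring.zero = (\<lambda>_. \<zero>\<^bsub>A\<^esub>), ring.add = (\<lambda>c c' x. c x \<oplus>\<^bsub>A\<^esub> c' x),
      smult = (\<lambda>a c x. c x \<otimes>\<^bsub>A\<^esub> a)\<rparr>"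

text \<open>
  For a right module \<open>M\<close>, the homomorphism to \<open>M\<close> from the free right module on a
  subset of \<open>M\<close> that extends the inclusion.
\<close>

definition free_eval ::
    "('a, 'k) ring_scheme \<Rightarrow> ('a, 'm, 'k1) module_scheme \<Rightarrow> ('m \<Rightarrow> 'a) \<Rightarrow> 'm" where
  "free_eval A M c = finsum M (\<lambda>x. c x \<odot>\<^bsub>M\<^esub> x) {x. c x \<noteq> \<zero>\<^bsub>A\<^esub>}"

text \<open>
  The beginning \<open>F2 \<rightarrow> F1 \<rightarrow> F0 \<rightarrow> M \<rightarrow> 0\<close> of the standard free resolution of a right
  module \<open>M\<close>: \<open>F0\<close> is free on the elements of \<open>M\<close>, and each further term is free on the
  elements of the preceding kernel. All maps are instances of \<^const>\<open>free_eval\<close>.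
\<close>

definition res0 :: "('a, 'k) ring_scheme \<Rightarrow> ('a, 'm, 'k1) module_scheme
    \<Rightarrow> ('a, 'm \<Rightarrow> 'a) module" where
  "res0 A M = free_right_module A (carrier M)"

definition res1 :: "('a, 'k) ring_scheme \<Rightarrow> ('a, 'm, 'k1) module_scheme
    \<Rightarrow> ('a, ('m \<Rightarrow> 'a) \<Rightarrow> 'a) module" where
  "res1 A M = free_right_module A (a_kernel (res0 A M) M (free_eval A M))"

definition res2 :: "('a, 'k) ring_scheme \<Rightarrow> ('a, 'm, 'k1) module_scheme
    \<Rightarrow> ('a, (('m \<Rightarrow> 'a) \<Rightarrow> 'a) \<Rightarrow> 'a) module" where
  "res2 A M =
     free_right_module A (a_kernel (res1 A M) (res0 A M) (free_eval A (res0 A M)))"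

text \<open>
  \<open>Tor1 A M N\<close> is the first homology of the complex
  \<open>F2 \<otimes> N \<rightarrow> F1 \<otimes> N \<rightarrow> F0 \<otimes> N\<close>.
\<close>

definition Tor1 ::
    "('a, 'k) ring_scheme \<Rightarrow> ('a, 'm, 'k1) module_scheme \<Rightarrow> ('a, 'n, 'k2) module_scheme
     \<Rightarrow> ((('m \<Rightarrow> 'a) \<Rightarrow> 'a) \<times> 'n \<Rightarrow>\<^sub>0 int) set set monoid" where
  "Tor1 A M N =
     (let G2 = tensor_prod A (res2 A M) N;
          G1 = tensor_prod A (res1 A M) N;
          G0 = tensor_prod A (res0 A M) N;
          d2 = tensor_map A (res1 A M) N (free_eval A (res1 A M));
          d1 = tensor_map A (res0 A M) N (free_eval A (res0 A M))
      in G1\<lparr>carrier := kernel G1 G0 d1\<rparr> Mod (d2 ` carrier G2))"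


section \<open>The regular operator ring as a module\<close>

definition R_left :: "('t::ab_group_add \<Rightarrow> 'g::ab_group_add \<Rightarrow> 't \<Rightarrow> 'g \<Rightarrow> 't \<Rightarrow> 't)
    \<Rightarrow> (int \<times> ('t, 'g) F set, 't \<Rightarrow> 't) module" where
  "R_left tern = ring.extend (End_ring\<lparr>carrier := rho_hat tern ` carrier (A_ring tern)\<rparr>)
     (module.fields (\<lambda>a f. rho_hat tern a \<otimes>\<^bsub>End_ring\<^esub> f))"

definition R_right :: "('t::ab_group_add \<Rightarrow> 'g::ab_group_add \<Rightarrow> 't \<Rightarrow> 'g \<Rightarrow> 't \<Rightarrow> 't)
    \<Rightarrow> (int \<times> ('t, 'g) F set, 't \<Rightarrow> 't) module" where
  "R_right tern = ring.extend (End_ring\<lparr>carrier := rho_hat tern ` carrier (A_ring tern)\<rparr>)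
     (module.fields (\<lambda>a f. f \<otimes>\<^bsub>End_ring\<^esub> rho_hat tern a))"

end

theory Submission
  imports Defs
begin

text \<open>
  Write \<open>A\<close> for the unital operator ring, \<open>h\<close> for the unital regular representation, \<open>K\<close>
  for its kernel and \<open>R\<close> for its image. If \<open>K = K\<^sup>2\<close>, then \<open>K\<close> equals all its powers, so it
  vanishes when it is nilpotent. It remains to see that \<open>K = K\<^sup>2\<close> as soon as \<open>Tor\<^sub>1(R, R) = 0\<close>.
  In the standard resolution \<open>F2 \<rightarrow> F1 \<rightarrow> F0 \<rightarrow> R\<close>, a section of \<open>h\<close> gives a lift
  \<open>g: F0 \<rightarrow> A\<close> of \<open>F0 \<rightarrow> R\<close>. It maps the image of \<open>\<partial>: F1 \<rightarrow> F0\<close> into \<open>K\<close>, so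
  \<open>w \<otimes> h a \<mapsto> g (\<partial> w) a\<close> is a well-defined map \<open>F1 \<otimes> R \<rightarrow> K/K\<^sup>2\<close> that vanishes on the
  image of \<open>F2 \<otimes> R\<close>. For \<open>k\<close> in \<open>K\<close> and the generator \<open>e\<close> of \<open>F1\<close> with \<open>\<partial> e = [1] k\<close>,
  the element \<open>e \<otimes> 1\<close> is a cycle since \<open>[1] k \<otimes> 1 = [1] \<otimes> k 1 = 0\<close>, and its image is the
  class of \<open>k\<close>.
\<close>

section \<open>Rings without unit and their unitization\<close>

text \<open>\<open>F\<close> and \<open>O\<close> carry a \<open>one\<close> field without meaning,
  so the axioms mention the sum and the product only.\<close>

locale rng = abelian_group R for R (structure) +
  assumes m_closed [intro, simp]:
      "\<lbrakk>x \<in> carrier R; y \<in> carrier R\<rbrakk> \<Longrightarrow> x \<otimes> y \<in> carrier R"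
    and m_assoc:
      "\<lbrakk>x \<in> carrier R; y \<in> carrier R; z \<in> carrier R\<rbrakk> \<Longrightarrow> x \<otimes> y \<otimes> z = x \<otimes> (y \<otimes> z)"
    and l_distr:
      "\<lbrakk>x \<in> carrier R; y \<in> carrier R; z \<in> carrier R\<rbrakk> \<Longrightarrow> (x \<oplus> y) \<otimes> z = x \<otimes> z \<oplus> y \<otimes> z"
    and r_distr:
      "\<lbrakk>x \<in> carrier R; y \<in> carrier R; z \<in> carrier R\<rbrakk> \<Longrightarrow> z \<otimes> (x \<oplus> y) = z \<otimes> x \<oplus> z \<otimes> y"
begin

lemma add_pow_mult_left:
  assumes "x \<in> carrier R" "y \<in> carrier R"
  shows "([(n::int)] \<cdot> x) \<otimes> y = [n] \<cdot> (x \<otimes> y)"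
  using hom_int_pow[of "\<lambda>x. x \<otimes> y" "add_monoid R" "add_monoid R" x n] assms a_group
  by (simp add: hom_def l_distr add_pow_def)

lemma add_pow_mult_right:
  assumes "x \<in> carrier R" "y \<in> carrier R"
  shows "x \<otimes> ([(n::int)] \<cdot> y) = [n] \<cdot> (x \<otimes> y)"
  using hom_int_pow[of "\<lambda>y. x \<otimes> y" "add_monoid R" "add_monoid R" y n] assms a_group
  by (simp add: hom_def r_distr add_pow_def)

lemma l_null [simp]: "x \<in> carrier R \<Longrightarrow> \<zero> \<otimes> x = \<zero>"
  using add_pow_mult_left[of \<zero> x 0] by (simp add: add_pow_def)

lemma r_null [simp]: "x \<in> carrier R \<Longrightarrow> x \<otimes> \<zero> = \<zero>"
  using add_pow_mult_right[of x \<zero> 0] by (simp add: add_pow_def)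

text \<open>The coset product is the union of \<open>I +> (a \<otimes> b)\<close> over all
  representatives. For a = i + x and b = j + y the product differs from xy by ij + iy + xj, which
  lies in \<open>I\<close>, so all members of the union coincide.\<close>

lemma
  assumes I: "rng_ideal R I" and x: "x \<in> carrier R" and y: "y \<in> carrier R"
  shows coset_add: "(I +> x) \<oplus>\<^bsub>R Quot I\<^esub> (I +> y) = I +> (x \<oplus> y)"
    and coset_mult: "(I +> x) \<otimes>\<^bsub>R Quot I\<^esub> (I +> y) = I +> (x \<otimes> y)"
proof -
  interpret I: abelian_subgroup I R
    using I by (intro abelian_subgroupI3) (auto simp: rng_ideal_def additive_subgroup_def abelian_group_axioms)
  show "(I +> x) \<oplus>\<^bsub>R Quot I\<^esub> (I +> y) = I +> (x \<oplus> y)"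
    using x y by (simp add: FactRing_def I.a_rcos_sum)
  have prod: "I +> (a \<otimes> b) = I +> (x \<otimes> y)" if a: "a \<in> I +> x" and b: "b \<in> I +> y" for a b
  proof -
    obtain i j where i: "i \<in> I" "a = i \<oplus> x" and j: "j \<in> I" "b = j \<oplus> y"
      using a b by (auto simp: a_r_coset_def')
    have "a \<otimes> b = (i \<otimes> j \<oplus> i \<otimes> y \<oplus> x \<otimes> j) \<oplus> x \<otimes> y"
      using i j x y by (simp add: l_distr r_distr a_ac)
    moreover have "i \<otimes> j \<oplus> i \<otimes> y \<oplus> x \<otimes> j \<in> I"
      using I i j x y by (auto simp: rng_ideal_def intro!: I.a_closed)
    ultimately have "a \<otimes> b \<in> I +> (x \<otimes> y)"
      by (auto simp: a_r_coset_def')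
    then show ?thesis
      using x y by (metis I.a_repr_independence' m_closed)
  qed
  have "(\<Union>a\<in>I +> x. \<Union>b\<in>I +> y. I +> (a \<otimes> b)) = (\<Union>a\<in>I +> x. \<Union>b\<in>I +> y. I +> (x \<otimes> y))"
    by (intro SUP_cong refl prod)
  \<comment> \<open>The cosets are nonempty, so a union of equal sets over them is that set.\<close>
  moreover have "x \<in> I +> x" "y \<in> I +> y"
    using x y by (simp_all add: I.a_rcos_self)
  then have "(\<Union>a\<in>I +> x. \<Union>b\<in>I +> y. I +> (x \<otimes> y)) = I +> (x \<otimes> y)"
    by blast
  ultimately show "(I +> x) \<otimes>\<^bsub>R Quot I\<^esub> (I +> y) = I +> (x \<otimes> y)"
    by (simp add: FactRing_def rcoset_mult_def)
qed

lemma rng_quotient: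
  assumes I: "rng_ideal R I"
  shows "rng (R Quot I)"
proof -
  interpret I: abelian_subgroup I R
    using I by (intro abelian_subgroupI3) (auto simp: rng_ideal_def additive_subgroup_def abelian_group_axioms)
  have carrier: "carrier (R Quot I) = (\<lambda>x. I +> x) ` carrier R"
    by (auto simp: FactRing_def A_RCOSETS_def')
  interpret Q: abelian_group "R Quot I"
    by (rule comm_group_abelian_groupI)
       (simp add: FactRing_def I.a_factorgroup_is_comm_group[unfolded A_FactGroup_def'])
  show ?thesis
    by unfold_locales
       (auto simp: carrier coset_add[OF I] coset_mult[OF I] m_assoc l_distr r_distr)
qed

end

section \<open>Adjoining a unit\<close>

definition unitization :: "('a, 'm) ring_scheme \<Rightarrow> (int \<times> 'a) ring" where
  "unitization R =
     \<lparr>carrier = UNIV \<times> carrier R,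
      monoid.mult = \<lambda>(n, r) (m, s). (n * m, ([n] \<cdot>\<^bsub>R\<^esub> s \<oplus>\<^bsub>R\<^esub> [m] \<cdot>\<^bsub>R\<^esub> r) \<oplus>\<^bsub>R\<^esub> r \<otimes>\<^bsub>R\<^esub> s),
      one = (1, \<zero>\<^bsub>R\<^esub>),
      ring.zero = (0, \<zero>\<^bsub>R\<^esub>),
      ring.add = \<lambda>(n, r) (m, s). (n + m, r \<oplus>\<^bsub>R\<^esub> s)\<rparr>"

lemma (in rng) ring_unitization: "ring (unitization R)"
proof (rule ringI)
  show "abelian_group (unitization R)"
  proof (rule abelian_groupI)
    fix x assume "x \<in> carrier (unitization R)"
    then show "\<exists>y\<in>carrier (unitization R). y \<oplus>\<^bsub>unitization R\<^esub> x = \<zero>\<^bsub>unitization R\<^esub>"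
      by (intro bexI[of _ "(- fst x, \<ominus> snd x)"]) (auto simp: unitization_def l_neg)
  qed (auto simp: unitization_def a_ac)
  show "Group.monoid (unitization R)"
  proof (rule monoidI)
    fix x y z
    assume "x \<in> carrier (unitization R)" "y \<in> carrier (unitization R)" "z \<in> carrier (unitization R)"
    then obtain n r m s k t where xyz: "x = (n, r)" "y = (m, s)" "z = (k, t)"
      and c: "r \<in> carrier R" "s \<in> carrier R" "t \<in> carrier R"
      by (auto simp: unitization_def)
    show "x \<otimes>\<^bsub>unitization R\<^esub> y \<otimes>\<^bsub>unitization R\<^esub> z = x \<otimes>\<^bsub>unitization R\<^esub> (y \<otimes>\<^bsub>unitization R\<^esub> z)"
      using c
      by (simp add: xyz unitization_def l_distr r_distr add.int_pow_distrib add.int_pow_pow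
          add_pow_mult_left add_pow_mult_right m_assoc a_ac mult_ac)
  qed (auto simp: unitization_def)
qed (auto simp: unitization_def l_distr r_distr add.int_pow_distrib add.int_pow_mult a_ac
      distrib_left distrib_right)

text \<open>The universal property of adjoining a unit: integer multiples of the unit are central in
  \<open>E\<close>, so (n1 + r u)(m1 + r v) expands to the image of the product of (n, u) and (m,
  v).\<close>

lemma unitization_lift_ring_hom:
  assumes "rng R" "ring E"
    and r: "r \<in> carrier R \<rightarrow> carrier E"
    and add: "\<And>x y. \<lbrakk>x \<in> carrier R; y \<in> carrier R\<rbrakk> \<Longrightarrow> r (x \<oplus>\<^bsub>R\<^esub> y) = r x \<oplus>\<^bsub>E\<^esub> r y"
    and mult: "\<And>x y. \<lbrakk>x \<in> carrier R; y \<in> carrier R\<rbrakk> \<Longrightarrow> r (x \<otimes>\<^bsub>R\<^esub> y) = r x \<otimes>\<^bsub>E\<^esub> r y"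
  shows "(\<lambda>(n, u). [n] \<cdot>\<^bsub>E\<^esub> \<one>\<^bsub>E\<^esub> \<oplus>\<^bsub>E\<^esub> r u) \<in> ring_hom (unitization R) E"
proof -
  interpret R: rng R by fact
  interpret E: ring E by fact
  interpret r: group_hom "add_monoid R" "add_monoid E" r
    using r add by unfold_locales (auto simp: hom_def)
  have closed [simp, intro]: "r x \<in> carrier E" if "x \<in> carrier R" for x
    using r that by auto
  have pow: "r ([(n::int)] \<cdot>\<^bsub>R\<^esub> x) = [n] \<cdot>\<^bsub>E\<^esub> r x" if "x \<in> carrier R" for n x
    using r.hom_int_pow[of x n] that by (simp add: add_pow_def)
  have zero: "r \<zero>\<^bsub>R\<^esub> = \<zero>\<^bsub>E\<^esub>"
    using r.hom_one by simp
  show ?thesis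
    by (rule ring_hom_memI)
       (auto simp: unitization_def add mult pow zero E.l_distr E.r_distr E.add.int_pow_distrib
         E.add.int_pow_mult E.add.int_pow_pow E.a_ac E.add_pow_ldistr_int E.add_pow_rdistr_int mult_ac)
qed

section \<open>The operator ring and the regular representation\<close>

text \<open>Pure tensors generate: \<open>tensor_induct\<close> is applied one factor at a time,
  from the innermost tensor outwards, and additivity of \<open>tns\<close> in its left argument
  turns inner differences into outer ones.\<close>

lemma tensor4_induct [case_names zero tns4 diff]:
  fixes x :: "((('a::ab_group_add, 'b::ab_group_add) tensor, 'c::ab_group_add) tensor,
    'd::ab_group_add) tensor"
  assumes zero: "P 0" and tns4: "\<And>a b c d. P (tns4 a b c d)"
    and diff: "\<And>x y. P x \<Longrightarrow> P y \<Longrightarrow> P (x - y)"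
  shows "P x"
proof -
  have tns_left [simp]: "Modules.additive (\<lambda>u. tns u v)" for v :: "'y::ab_group_add"
    by (rule Modules.additive.intro) (rule tns_add_left)
  note additive_rules = Modules.additive.zero[OF tns_left] Modules.additive.diff[OF tns_left]
  have 1: "P (tns (tns u c) d)" for u c d
    by (induction u rule: tensor_induct)
       (use zero diff tns4 in \<open>simp_all add: additive_rules flip: tns4_def\<close>)
  have 2: "P (tns u d)" for u d
    by (induction u rule: tensor_induct) (use zero diff 1 in \<open>simp_all add: additive_rules\<close>)
  show ?thesis
    by (induction x rule: tensor_induct) (use zero diff 2 in simp_all)
qed

text \<open>The equations of \<open>tensor_lift\<close> are available for biadditive arguments.
  Hence each partial lift is first shown additive in the parameters still free, by induction on its
  tensor argument.\<close>

lemma tensor4_lift: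
  fixes f :: "'a::ab_group_add \<Rightarrow> 'b::ab_group_add \<Rightarrow> 'c::ab_group_add \<Rightarrow> 'd::ab_group_add
       \<Rightarrow> 'e::ab_group_add"
  assumes 1: "\<And>a a' b c d. f (a + a') b c d = f a b c d + f a' b c d"
    and 2: "\<And>a b b' c d. f a (b + b') c d = f a b c d + f a b' c d"
    and 3: "\<And>a b c c' d. f a b (c + c') d = f a b c d + f a b c' d"
    and 4: "\<And>a b c d d'. f a b c (d + d') = f a b c d + f a b c d'"
  shows "Modules.additive (tensor4_lift f)" "tensor4_lift f (tns4 a b c d) = f a b c d"
proof -
  define f2 where "f2 c d = tensor_lift (\<lambda>a b. f a b c d)" for c d
  have f2: "Modules.additive (f2 c d)" "f2 c d (tns a b) = f a b c d" for a b c d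
    unfolding f2_def by (rule tensor_lift; simp add: 1 2)+
  have f2_add: "f2 (c + c') d u = f2 c d u + f2 c' d u" "f2 c (d + d') u = f2 c d u + f2 c d' u"
    for c c' d d' u
    by (induction u rule: tensor_induct)
       (simp_all add: Modules.additive.zero[OF f2(1)] Modules.additive.diff[OF f2(1)] f2(2) 3 4)
  define f3 where "f3 d = tensor_lift (\<lambda>v c. f2 c d v)" for d
  have f3: "Modules.additive (f3 d)" "f3 d (tns u c) = f2 c d u" for u c d
    unfolding f3_def by (rule tensor_lift; simp add: f2_add Modules.additive.add[OF f2(1)])+
  have f3_add: "f3 (d + d') u = f3 d u + f3 d' u" for d d' u
    by (induction u rule: tensor_induct)
       (simp_all add: Modules.additive.zero[OF f3(1)] Modules.additive.diff[OF f3(1)] f3(2) f2_add)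
  have eq: "tensor4_lift f = tensor_lift (\<lambda>u d. f3 d u)"
    by (simp add: tensor4_lift_def f3_def f2_def)
  have f4: "Modules.additive (tensor_lift (\<lambda>u d. f3 d u))"
    "tensor_lift (\<lambda>u d. f3 d u) (tns u d) = f3 d u" for u d
    by (rule tensor_lift; simp add: f3_add Modules.additive.add[OF f3(1)])+
  show "Modules.additive (tensor4_lift f)" "tensor4_lift f (tns4 a b c d) = f a b c d"
    by (simp_all add: eq f4 f3 f2 tns4_def)
qed

lemma tns4_add:
  "tns4 (a + a') b c d = tns4 a b c d + tns4 a' b c d"
  "tns4 a (b + b') c d = tns4 a b c d + tns4 a b' c d"
  "tns4 a b (c + c') d = tns4 a b c d + tns4 a b c' d"
  "tns4 a b c (d + d') = tns4 a b c d + tns4 a b c d'"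
  by (simp_all add: tns4_def tns_add_left tns_add_right)

section \<open>The multiplication of \<open>F\<close> and the ideal \<open>J\<close>\<close>

context ternary_gamma_ring
begin

lemmas tern_add = additive1[THEN Modules.additive.add] additive2[THEN Modules.additive.add]
  additive3[THEN Modules.additive.add] additive4[THEN Modules.additive.add]
  additive5[THEN Modules.additive.add]

text \<open>The inner lift in \<open>F_mult\<close>: left multiplication by a pure tensor.\<close>

definition pure_mult :: "'t \<Rightarrow> 'g \<Rightarrow> 't \<Rightarrow> 'g \<Rightarrow> ('t, 'g) F \<Rightarrow> ('t, 'g) F" where
  "pure_mult a \<alpha> b \<beta> = tensor4_lift (\<lambda>c \<gamma> d \<delta>. tns4 (tern a \<alpha> b \<beta> c) \<gamma> d \<delta>)"

lemma pure_mult: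
  "Modules.additive (pure_mult a \<alpha> b \<beta>)"
  "pure_mult a \<alpha> b \<beta> (tns4 c \<gamma> d \<delta>) = tns4 (tern a \<alpha> b \<beta> c) \<gamma> d \<delta>"
  unfolding pure_mult_def by (rule tensor4_lift; simp add: tern_add tns4_add)+

text \<open>Additivity in the four left parameters is what the outer lift of \<open>F_mult\<close>
  requires.\<close>

lemma pure_mult_add:
  "pure_mult (a + a') \<alpha> b \<beta> = pure_mult a \<alpha> b \<beta> + pure_mult a' \<alpha> b \<beta>"
  "pure_mult a (\<alpha> + \<alpha>') b \<beta> = pure_mult a \<alpha> b \<beta> + pure_mult a \<alpha>' b \<beta>"
  "pure_mult a \<alpha> (b + b') \<beta> = pure_mult a \<alpha> b \<beta> + pure_mult a \<alpha> b' \<beta>"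
  "pure_mult a \<alpha> b (\<beta> + \<beta>') = pure_mult a \<alpha> b \<beta> + pure_mult a \<alpha> b \<beta>'"
  unfolding fun_eq_iff plus_fun_def
  by (rule allI, rule tensor4_induct;
      simp add: pure_mult tern_add tns4_add
        Modules.additive.zero[OF pure_mult(1)] Modules.additive.diff[OF pure_mult(1)])+

lemma F_mult:
  "F_mult tern (x + y) z = F_mult tern x z + F_mult tern y z"
  "F_mult tern x (y + z) = F_mult tern x y + F_mult tern x z"
  "F_mult tern (tns4 a \<alpha> b \<beta>) = pure_mult a \<alpha> b \<beta>"
proof -
  have eq: "F_mult tern = tensor4_lift pure_mult"
    by (simp add: F_mult_def pure_mult_def[abs_def])
  have lift: "Modules.additive (tensor4_lift pure_mult)"
    "tensor4_lift pure_mult (tns4 a \<alpha> b \<beta>) = pure_mult a \<alpha> b \<beta>" for a \<alpha> b \<beta>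
    by (rule tensor4_lift; simp add: pure_mult_add)+
  show "F_mult tern (tns4 a \<alpha> b \<beta>) = pure_mult a \<alpha> b \<beta>"
    by (simp add: eq lift)
  show "F_mult tern (x + y) z = F_mult tern x z + F_mult tern y z"
    by (simp add: eq Modules.additive.add[OF lift(1)])
  \<comment> \<open>The outer lift gives additivity in \<open>x\<close>; additivity on the right
    holds for a pure left factor and spreads by induction.\<close>
  show "F_mult tern x (y + z) = F_mult tern x y + F_mult tern x z"
    by (induction x rule: tensor4_induct)
       (simp_all add: eq lift Modules.additive.zero[OF lift(1)] Modules.additive.diff[OF lift(1)]
         Modules.additive.add[OF pure_mult(1)])
qed

lemma F_mult_diff:
  "F_mult tern (x - y) z = F_mult tern x z - F_mult tern y z"
  "F_mult tern x (y - z) = F_mult tern x y - F_mult tern x z"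
  by (simp_all add: eq_diff_eq flip: F_mult)

lemma F_mult_zero [simp]: "F_mult tern 0 x = 0" "F_mult tern x 0 = 0"
  using F_mult_diff(1)[of 0 0 x] F_mult_diff(2)[of x 0 0] by simp_all

text \<open>Both sides are additive in each factor, so pure tensors suffice. There the first entries
  are (a \<alpha> b \<beta> c) \<gamma> d \<delta> e and a \<alpha> b \<beta> (c \<gamma> d \<delta>
  e), equal by the two ternary laws together.\<close>

lemma F_mult_assoc: "F_mult tern (F_mult tern x y) z = F_mult tern x (F_mult tern y z)"
proof (induction x rule: tensor4_induct)
  case (tns4 a \<alpha> b \<beta>)
  show ?case
  proof (induction y rule: tensor4_induct)
    case (tns4 c \<gamma> d \<delta>)
    show ?case
      by (induction z rule: tensor4_induct)
         (simp_all add: F_mult_diff F_mult(3) pure_mult(2) assoc_left assoc_right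
           Modules.additive.zero[OF pure_mult(1)] Modules.additive.diff[OF pure_mult(1)])
  qed (simp_all add: F_mult_diff)
qed (simp_all add: F_mult_diff)

lemma rng_F: "rng (F_ring tern)"
proof (intro rng.intro abelian_groupI rng_axioms.intro)
  fix x assume "x \<in> carrier (F_ring tern)"
  show "\<exists>y\<in>carrier (F_ring tern). y \<oplus>\<^bsub>F_ring tern\<^esub> x = \<zero>\<^bsub>F_ring tern\<^esub>"
    by (rule bexI[of _ "- x"]) (auto simp: F_ring_def)
qed (auto simp: F_ring_def F_mult F_mult_assoc add_ac)

lemma F_ring_minus: "\<ominus>\<^bsub>F_ring tern\<^esub> x = - x"
proof -
  interpret F: rng "F_ring tern" by (rule rng_F)
  show ?thesis
    by (rule F.minus_equality) (auto simp: F_ring_def)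
qed

lemma rng_ideal_F_iff:
  "rng_ideal (F_ring tern) I \<longleftrightarrow>
     0 \<in> I \<and> (\<forall>x\<in>I. \<forall>y\<in>I. x + y \<in> I) \<and> (\<forall>x\<in>I. - x \<in> I) \<and>
     (\<forall>x. \<forall>i\<in>I. F_mult tern x i \<in> I \<and> F_mult tern i x \<in> I)"
  using F_ring_minus
  by (auto simp: rng_ideal_def subgroup_def a_inv_def F_ring_def)

lemma rng_ideal_J: "rng_ideal (F_ring tern) (J_ideal tern)"
  unfolding J_ideal_def rng_genideal_def by (simp add: rng_ideal_F_iff)

section \<open>Left multiplication operators and their vanishing on \<open>J\<close>\<close>

definition left_mult :: "('t, 'g) F \<Rightarrow> 't \<Rightarrow> 't" where
  "left_mult = tensor4_lift (\<lambda>a \<alpha> b \<beta>. \<lambda>x. tern a \<alpha> b \<beta> x)"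

lemma left_mult:
  "left_mult (tns4 a \<alpha> b \<beta>) x = tern a \<alpha> b \<beta> x"
  "left_mult (u + v) = left_mult u + left_mult v"
  "left_mult (u - v) = left_mult u - left_mult v"
  "left_mult 0 = 0"
  "left_mult (- u) = - left_mult u"
proof -
  have lift: "Modules.additive left_mult"
    "left_mult (tns4 a \<alpha> b \<beta>) = (\<lambda>x. tern a \<alpha> b \<beta> x)" for a \<alpha> b \<beta>
    unfolding left_mult_def by (rule tensor4_lift; simp add: fun_eq_iff tern_add)+
  then show "left_mult (tns4 a \<alpha> b \<beta>) x = tern a \<alpha> b \<beta> x" by simp
  show "left_mult (u + v) = left_mult u + left_mult v"
    "left_mult (u - v) = left_mult u - left_mult v" "left_mult 0 = 0"
    "left_mult (- u) = - left_mult u"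
    using lift(1) by (simp_all only: Modules.additive.add Modules.additive.diff
        Modules.additive.zero Modules.additive.minus)
qed

lemma additive_left_mult: "Modules.additive (left_mult u)"
proof (rule Modules.additive.intro)
  show "left_mult u (x + y) = left_mult u x + left_mult u y" for x y
    by (induction u rule: tensor4_induct) (simp_all add: left_mult tern_add)
qed

lemma left_mult_F_mult: "left_mult (F_mult tern u v) = left_mult u \<circ> left_mult v"
proof
  note additive = Modules.additive.diff[OF additive_left_mult] Modules.additive.zero[OF additive_left_mult]
  show "left_mult (F_mult tern u v) x = (left_mult u \<circ> left_mult v) x" for x
  proof (induction u rule: tensor4_induct)
    case (tns4 a \<alpha> b \<beta>)
    show ?case
      by (induction v rule: tensor4_induct)
         (simp_all add: F_mult_diff left_mult F_mult(3) pure_mult(2) assoc_left assoc_right additive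
           Modules.additive.zero[OF pure_mult(1)] Modules.additive.diff[OF pure_mult(1)]
           Modules.additive.zero[OF additive5] Modules.additive.diff[OF additive5])
  qed (simp_all add: F_mult_diff left_mult)
qed

text \<open>The kernel of \<open>left_mult\<close> is a two-sided ideal, as products become
  compositions of additive operators, and \<open>assoc_left\<close> puts the generators of
  \<open>J\<close> into it. \<open>J\<close> is the least such ideal.\<close>

lemma left_mult_J:
  assumes "u \<in> J_ideal tern"
  shows "left_mult u = 0"
proof -
  have "rng_ideal (F_ring tern) {u. left_mult u = 0}"
    using additive_left_mult[THEN Modules.additive.zero]
    by (auto simp: rng_ideal_F_iff left_mult left_mult_F_mult fun_eq_iff)
  moreover have "tns4 (tern a \<alpha> b \<beta> c) \<gamma> d \<delta> - tns4 a \<alpha> (tern b \<beta> c \<gamma> d) \<delta> \<in> {u. left_mult u = 0}"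
    for a \<alpha> b \<beta> c \<gamma> d \<delta>
    by (simp add: fun_eq_iff left_mult assoc_left)
  ultimately have "J_ideal tern \<subseteq> {u. left_mult u = 0}"
    unfolding J_ideal_def rng_genideal_def by (intro Inter_lower) auto
  then show ?thesis using assms by blast
qed

text \<open>By \<open>left_mult_J\<close> the operator is constant on a coset, so the image is a
  singleton and \<open>the_elem\<close> reads off its value.\<close>

lemma rho_coset: "rho tern (J_ideal tern +>\<^bsub>F_ring tern\<^esub> u) = left_mult u"
proof -
  have "left_mult ` (J_ideal tern +>\<^bsub>F_ring tern\<^esub> u) = {left_mult u}"
    using rng_ideal_J[unfolded rng_ideal_F_iff]
    by (auto simp: a_r_coset_def' F_ring_def left_mult left_mult_J)
  then show ?thesis
    by (simp add: rho_def flip: left_mult_def)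
qed

section \<open>The endomorphism ring and the operator ring\<close>

lemma ring_End: "ring (End_ring :: ('t \<Rightarrow> 't) ring)"
proof (rule ringI)
  show "abelian_group (End_ring :: ('t \<Rightarrow> 't) ring)"
  proof (rule abelian_groupI)
    fix f :: "'t \<Rightarrow> 't" assume "f \<in> carrier End_ring"
    then show "\<exists>g\<in>carrier End_ring. g \<oplus>\<^bsub>End_ring\<^esub> f = \<zero>\<^bsub>End_ring\<^esub>"
      by (intro bexI[of _ "\<lambda>x. - f x"]) (auto simp: End_ring_def Modules.additive_def)
  qed (auto simp: End_ring_def Modules.additive_def add_ac)
  show "Group.monoid (End_ring :: ('t \<Rightarrow> 't) ring)"
    by (rule monoidI) (auto simp: End_ring_def Modules.additive_def)
qed (auto simp: End_ring_def Modules.additive_def)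

text \<open>\<open>A_ring\<close> is the unitization of the quotient \<open>O_ring\<close>, and
  \<open>rho_hat\<close> is the unital extension of \<open>rho\<close>, with \<open>id\<close> as
  the unit of \<open>End_ring\<close>. That \<open>rho\<close> respects sums and products is read
  off from representatives through \<open>rho_coset\<close>.\<close>

lemma ring_A: "ring (A_ring tern)" and rho_hat_ring_hom: "rho_hat tern \<in> ring_hom (A_ring tern) End_ring"
proof -
  interpret F: rng "F_ring tern" by (rule rng_F)
  interpret O: rng "O_ring tern"
    unfolding O_ring_def by (rule F.rng_quotient) (rule rng_ideal_J)
  have A: "A_ring tern = unitization (O_ring tern)"
    by (simp add: A_ring_def unitization_def Let_def)
  have carrier: "carrier (O_ring tern) = range (\<lambda>u. J_ideal tern +>\<^bsub>F_ring tern\<^esub> u)"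
    by (auto simp: O_ring_def FactRing_def A_RCOSETS_def' F_ring_def)
  have in_F: "u \<in> carrier (F_ring tern)" for u
    by (simp add: F_ring_def)
  have one: "\<one>\<^bsub>End_ring\<^esub> = id"
    by (simp add: End_ring_def)
  show "ring (A_ring tern)"
    unfolding A by (rule O.ring_unitization)
  have "(\<lambda>(n, u). [n] \<cdot>\<^bsub>End_ring\<^esub> \<one>\<^bsub>End_ring\<^esub> \<oplus>\<^bsub>End_ring\<^esub> rho tern u)
      \<in> ring_hom (unitization (O_ring tern)) End_ring"
  proof (rule unitization_lift_ring_hom[OF O.rng_axioms ring_End])
    show "rho tern \<in> carrier (O_ring tern) \<rightarrow> carrier End_ring"
      by (auto simp: carrier rho_coset End_ring_def additive_left_mult)
    fix x y assume "x \<in> carrier (O_ring tern)" "y \<in> carrier (O_ring tern)"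
    then obtain u v where xy: "x = J_ideal tern +>\<^bsub>F_ring tern\<^esub> u" "y = J_ideal tern +>\<^bsub>F_ring tern\<^esub> v"
      by (auto simp: carrier)
    show "rho tern (x \<oplus>\<^bsub>O_ring tern\<^esub> y) = rho tern x \<oplus>\<^bsub>End_ring\<^esub> rho tern y"
      unfolding xy O_ring_def F.coset_add[OF rng_ideal_J in_F in_F] rho_coset
      by (simp add: F_ring_def left_mult End_ring_def plus_fun_def)
    show "rho tern (x \<otimes>\<^bsub>O_ring tern\<^esub> y) = rho tern x \<otimes>\<^bsub>End_ring\<^esub> rho tern y"
      unfolding xy O_ring_def F.coset_mult[OF rng_ideal_J in_F in_F] rho_coset
      by (simp add: F_ring_def left_mult_F_mult End_ring_def)
  qed
  then show "rho_hat tern \<in> ring_hom (A_ring tern) End_ring"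
    by (simp add: rho_hat_def A one)
qed

end

section \<open>Right modules and free right modules\<close>

text \<open>Closure under the action already makes the balanced relations lie in the free group.
  This weak structure is the one given to the left module \<open>N\<close> below.\<close>

locale ring_action = R?: ring R + M?: abelian_group M
  for R :: "('a, 'r) ring_scheme" (structure) and M :: "('a, 'm, 'k) module_scheme" (structure) +
  assumes smult_closed [simp, intro]:
    "\<lbrakk>a \<in> carrier R; x \<in> carrier M\<rbrakk> \<Longrightarrow> a \<odot>\<^bsub>M\<^esub> x \<in> carrier M"

text \<open>Scalars are written on the left but act from the right, whence the reversed order in
  \<open>smult_assoc\<close>.\<close>

locale right_module = ring_action +
  assumes smult_l_distr:
      "\<lbrakk>a \<in> carrier R; b \<in> carrier R; x \<in> carrier M\<rbrakk> \<Longrightarrow>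
        (a \<oplus>\<^bsub>R\<^esub> b) \<odot>\<^bsub>M\<^esub> x = a \<odot>\<^bsub>M\<^esub> x \<oplus>\<^bsub>M\<^esub> b \<odot>\<^bsub>M\<^esub> x"
    and smult_r_distr:
      "\<lbrakk>a \<in> carrier R; x \<in> carrier M; y \<in> carrier M\<rbrakk> \<Longrightarrow>
        a \<odot>\<^bsub>M\<^esub> (x \<oplus>\<^bsub>M\<^esub> y) = a \<odot>\<^bsub>M\<^esub> x \<oplus>\<^bsub>M\<^esub> a \<odot>\<^bsub>M\<^esub> y"
    and smult_assoc:
      "\<lbrakk>a \<in> carrier R; b \<in> carrier R; x \<in> carrier M\<rbrakk> \<Longrightarrow>
        (a \<otimes>\<^bsub>R\<^esub> b) \<odot>\<^bsub>M\<^esub> x = b \<odot>\<^bsub>M\<^esub> (a \<odot>\<^bsub>M\<^esub> x)"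
    and smult_one [simp]: "x \<in> carrier M \<Longrightarrow> \<one>\<^bsub>R\<^esub> \<odot>\<^bsub>M\<^esub> x = x"
begin

lemma smult_l_null [simp]: "x \<in> carrier M \<Longrightarrow> \<zero>\<^bsub>R\<^esub> \<odot>\<^bsub>M\<^esub> x = \<zero>\<^bsub>M\<^esub>"
  using smult_l_distr[of "\<zero>\<^bsub>R\<^esub>" "\<zero>\<^bsub>R\<^esub>" x] by (simp add: M.add.l_cancel_one')

lemma smult_r_null [simp]: "a \<in> carrier R \<Longrightarrow> a \<odot>\<^bsub>M\<^esub> \<zero>\<^bsub>M\<^esub> = \<zero>\<^bsub>M\<^esub>"
  using smult_r_distr[of a "\<zero>\<^bsub>M\<^esub>" "\<zero>\<^bsub>M\<^esub>"] by (simp add: M.add.l_cancel_one')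

end

text \<open>The index set may be infinite: then both sums are zero by convention, and
  \<open>f\<close> preserves zero.\<close>

lemma hom_finsum:
  assumes "abelian_group G" "abelian_group H" "f \<in> hom (add_monoid G) (add_monoid H)"
    and "u \<in> S \<rightarrow> carrier G"
  shows "f (finsum G u S) = finsum H (\<lambda>x. f (u x)) S"
proof -
  interpret G: abelian_group G by fact
  interpret H: abelian_group H by fact
  interpret f: group_hom "add_monoid G" "add_monoid H" f
    using assms(3) by unfold_locales
  have [simp]: "f \<zero>\<^bsub>G\<^esub> = \<zero>\<^bsub>H\<^esub>" using f.hom_one by simp
  have [simp]: "f x \<in> carrier H" if "x \<in> carrier G" for x using f.hom_closed that by simp
  have [simp]: "f (x \<oplus>\<^bsub>G\<^esub> y) = f x \<oplus>\<^bsub>H\<^esub> f y" if "x \<in> carrier G" "y \<in> carrier G" for x y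
    using f.hom_mult that by simp
  show ?thesis
    using assms(4)
  proof (induction S rule: infinite_finite_induct)
    case (insert x S)
    then show ?case
      by (simp add: G.finsum_insert H.finsum_insert Pi_def)
  qed (simp_all add: G.finsum_infinite H.finsum_infinite G.finsum_empty H.finsum_empty)
qed

text \<open>The homomorphism out of a free right module prescribed by \<open>t\<close> on the basis.
  Inclusions give \<open>free_eval\<close>; the section \<open>sec\<close> below gives a lift to
  \<open>A\<close>.\<close>

definition free_extend ::
    "('a, 'k) ring_scheme \<Rightarrow> ('a, 'm, 'k1) module_scheme \<Rightarrow> ('x \<Rightarrow> 'm) \<Rightarrow> ('x \<Rightarrow> 'a) \<Rightarrow> 'm" where
  "free_extend A M t c = finsum M (\<lambda>x. c x \<odot>\<^bsub>M\<^esub> t x) {x. c x \<noteq> \<zero>\<^bsub>A\<^esub>}"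

lemma free_eval_eq: "free_eval A M = free_extend A M (\<lambda>x. x)"
  by (simp add: fun_eq_iff free_eval_def free_extend_def)

definition single :: "('a, 'k) ring_scheme \<Rightarrow> 'x \<Rightarrow> 'a \<Rightarrow> 'x \<Rightarrow> 'a" where
  "single A x a = (\<lambda>y. if y = x then a else \<zero>\<^bsub>A\<^esub>)"

lemma free_right_module_simps:
  "\<zero>\<^bsub>free_right_module A U\<^esub> = (\<lambda>_. \<zero>\<^bsub>A\<^esub>)"
  "c \<oplus>\<^bsub>free_right_module A U\<^esub> c' = (\<lambda>x. c x \<oplus>\<^bsub>A\<^esub> c' x)"
  "a \<odot>\<^bsub>free_right_module A U\<^esub> c = (\<lambda>x. c x \<otimes>\<^bsub>A\<^esub> a)"
  "c \<in> carrier (free_right_module A U) \<longleftrightarrow>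
     (\<forall>x. c x \<in> carrier A) \<and> {x. c x \<noteq> \<zero>\<^bsub>A\<^esub>} \<subseteq> U \<and> finite {x. c x \<noteq> \<zero>\<^bsub>A\<^esub>}"
  by (simp_all add: free_right_module_def)

lemma (in ring) free_right_module_closed:
  assumes c: "c \<in> carrier (free_right_module R U)"
  shows "c' \<in> carrier (free_right_module R U) \<Longrightarrow> (\<lambda>x. c x \<oplus> c' x) \<in> carrier (free_right_module R U)"
    and "a \<in> carrier R \<Longrightarrow> (\<lambda>x. c x \<otimes> a) \<in> carrier (free_right_module R U)"
    and "(\<lambda>x. \<ominus> c x) \<in> carrier (free_right_module R U)"
proof -
  \<comment> \<open>A finite set containing the support is enough; sums and multiples may lose
    coefficients, so the exact support is not known.\<close>
  have sub: "f \<in> carrier (free_right_module R U)"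
    if "\<And>x. f x \<in> carrier R" "\<And>x. x \<notin> S \<Longrightarrow> f x = \<zero>" "finite S" "S \<subseteq> U" for f S
    using that finite_subset[of "{x. f x \<noteq> \<zero>}" S]
    unfolding free_right_module_simps by blast
  show "(\<lambda>x. c x \<otimes> a) \<in> carrier (free_right_module R U)" if "a \<in> carrier R"
    using c that by (intro sub[of _ "{x. c x \<noteq> \<zero>}"]) (auto simp: free_right_module_simps)
  show "(\<lambda>x. \<ominus> c x) \<in> carrier (free_right_module R U)"
    using c by (intro sub[of _ "{x. c x \<noteq> \<zero>}"]) (auto simp: free_right_module_simps)
  show "(\<lambda>x. c x \<oplus> c' x) \<in> carrier (free_right_module R U)"
    if "c' \<in> carrier (free_right_module R U)"
    using c that
    by (intro sub[of _ "{x. c x \<noteq> \<zero>} \<union> {x. c' x \<noteq> \<zero>}"]) (auto simp: free_right_module_simps)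
qed

lemma free_right_module_coeff: "c \<in> carrier (free_right_module A U) \<Longrightarrow> c x \<in> carrier A"
  by (simp add: free_right_module_simps)

lemma (in ring) free_right_module_zero_closed: "(\<lambda>_. \<zero>) \<in> carrier (free_right_module R U)"
  by (simp add: free_right_module_simps)

lemma (in ring) right_module_free: "right_module R (free_right_module R U)"
proof (intro right_module.intro ring_action.intro right_module_axioms.intro ring_action_axioms.intro)
  show "ring R" by (rule ring_axioms)
  show "abelian_group (free_right_module R U)"
  proof (rule abelian_groupI)
    show "\<exists>d\<in>carrier (free_right_module R U). d \<oplus>\<^bsub>free_right_module R U\<^esub> c = \<zero>\<^bsub>free_right_module R U\<^esub>"
      if "c \<in> carrier (free_right_module R U)" for c
      using that free_right_module_closed(3)[OF that]
      by (intro bexI[of _ "\<lambda>x. \<ominus> c x"]) (auto simp: free_right_module_simps l_neg)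
  qed (simp_all add: free_right_module_simps(1-3) free_right_module_closed
        free_right_module_zero_closed free_right_module_coeff a_ac)
qed (simp_all add: free_right_module_simps(1-3) free_right_module_closed
      free_right_module_coeff m_assoc l_distr r_distr)

lemma (in ring) single_closed:
  "a \<in> carrier R \<Longrightarrow> x \<in> U \<Longrightarrow> single R x a \<in> carrier (free_right_module R U)"
proof -
  assume "a \<in> carrier R" "x \<in> U"
  moreover have "{y. single R x a y \<noteq> \<zero>} \<subseteq> {x}" by (auto simp: single_def)
  ultimately show ?thesis
    by (auto simp: free_right_module_simps single_def finite_subset)
qed

context right_module
begin

text \<open>Supports can shrink under addition and action, so sums are compared over a common finite
  set \<open>S\<close>; the extra terms have coefficient zero.\<close>

lemma free_extend_eq:
  assumes c: "c \<in> carrier (free_right_module R U)" and t: "t \<in> U \<rightarrow> carrier M"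
    and S: "finite S" "{x. c x \<noteq> \<zero>\<^bsub>R\<^esub>} \<subseteq> S" "S \<subseteq> U"
  shows "free_extend R M t c = finsum M (\<lambda>x. c x \<odot>\<^bsub>M\<^esub> t x) S"
  unfolding free_extend_def using assms
  by (intro M.add.finprod_mono_neutral_cong_left) (auto simp: free_right_module_simps Pi_iff subset_iff)

lemma free_extend_hom:
  assumes t: "t \<in> U \<rightarrow> carrier M"
  shows "free_extend R M t \<in> hom (add_monoid (free_right_module R U)) (add_monoid M)"
proof -
  have closed: "free_extend R M t c \<in> carrier M" if "c \<in> carrier (free_right_module R U)" for c
    unfolding free_extend_def using that t
    by (intro M.finsum_closed) (auto simp: free_right_module_simps)
  have "free_extend R M t (c \<oplus>\<^bsub>free_right_module R U\<^esub> d) = free_extend R M t c \<oplus>\<^bsub>M\<^esub> free_extend R M t d"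
    if c: "c \<in> carrier (free_right_module R U)" and d: "d \<in> carrier (free_right_module R U)" for c d
  proof -
    define S where "S = {x. c x \<noteq> \<zero>\<^bsub>R\<^esub>} \<union> {x. d x \<noteq> \<zero>\<^bsub>R\<^esub>}"
    have S: "finite S" "S \<subseteq> U" using c d by (auto simp: S_def free_right_module_simps)
    have "free_extend R M t (\<lambda>x. c x \<oplus>\<^bsub>R\<^esub> d x) = finsum M (\<lambda>x. (c x \<oplus>\<^bsub>R\<^esub> d x) \<odot>\<^bsub>M\<^esub> t x) S"
      using S R.free_right_module_closed(1)[OF c d]
      by (intro free_extend_eq[OF _ t]) (auto simp: S_def)
    also have "\<dots> = finsum M (\<lambda>x. c x \<odot>\<^bsub>M\<^esub> t x \<oplus>\<^bsub>M\<^esub> d x \<odot>\<^bsub>M\<^esub> t x) S"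
      using c d t S by (intro M.finsum_cong') (auto simp: smult_l_distr free_right_module_simps Pi_iff subset_iff)
    also have "\<dots> = finsum M (\<lambda>x. c x \<odot>\<^bsub>M\<^esub> t x) S \<oplus>\<^bsub>M\<^esub> finsum M (\<lambda>x. d x \<odot>\<^bsub>M\<^esub> t x) S"
      using c d t S by (intro M.finsum_addf) (auto simp: free_right_module_simps Pi_iff subset_iff)
    also have "\<dots> = free_extend R M t c \<oplus>\<^bsub>M\<^esub> free_extend R M t d"
      using free_extend_eq[OF c t S(1) _ S(2)] free_extend_eq[OF d t S(1) _ S(2)]
      by (simp add: S_def)
    finally show ?thesis by (simp add: free_right_module_simps)
  qed
  then show ?thesis using closed by (simp add: hom_def)
qed

lemma free_extend_closed:
  "\<lbrakk>t \<in> U \<rightarrow> carrier M; c \<in> carrier (free_right_module R U)\<rbrakk> \<Longrightarrow> free_extend R M t c \<in> carrier M"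
  using free_extend_hom[of t U] by (auto simp: hom_def)

lemma free_extend_add:
  "\<lbrakk>t \<in> U \<rightarrow> carrier M; c \<in> carrier (free_right_module R U); d \<in> carrier (free_right_module R U)\<rbrakk> \<Longrightarrow>
    free_extend R M t (c \<oplus>\<^bsub>free_right_module R U\<^esub> d) = free_extend R M t c \<oplus>\<^bsub>M\<^esub> free_extend R M t d"
  using free_extend_hom[of t U] by (auto simp: hom_def)

lemma free_extend_zero: "free_extend R M t (\<lambda>_. \<zero>\<^bsub>R\<^esub>) = \<zero>\<^bsub>M\<^esub>"
  by (simp add: free_extend_def M.finsum_empty)

lemma free_extend_smult:
  assumes t: "t \<in> U \<rightarrow> carrier M" and c: "c \<in> carrier (free_right_module R U)" and a: "a \<in> carrier R"
  shows "free_extend R M t (a \<odot>\<^bsub>free_right_module R U\<^esub> c) = a \<odot>\<^bsub>M\<^esub> free_extend R M t c"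
proof -
  define S where "S = {x. c x \<noteq> \<zero>\<^bsub>R\<^esub>}"
  have S: "finite S" "S \<subseteq> U" using c by (auto simp: S_def free_right_module_simps)
  have "free_extend R M t (\<lambda>x. c x \<otimes>\<^bsub>R\<^esub> a) = finsum M (\<lambda>x. (c x \<otimes>\<^bsub>R\<^esub> a) \<odot>\<^bsub>M\<^esub> t x) S"
    using S R.free_right_module_closed(2)[OF c a] a
    by (intro free_extend_eq[OF _ t]) (auto simp: S_def)
  also have "\<dots> = finsum M (\<lambda>x. a \<odot>\<^bsub>M\<^esub> (c x \<odot>\<^bsub>M\<^esub> t x)) S"
    using c a t S by (intro M.finsum_cong') (auto simp: smult_assoc free_right_module_simps Pi_iff subset_iff)
  also have "\<dots> = a \<odot>\<^bsub>M\<^esub> finsum M (\<lambda>x. c x \<odot>\<^bsub>M\<^esub> t x) S"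
    using c a t S M.abelian_group_axioms
    by (intro hom_finsum[symmetric])
       (auto simp: hom_def smult_r_distr free_right_module_simps Pi_iff subset_iff)
  finally show ?thesis
    by (simp add: free_right_module_simps free_extend_def S_def)
qed

lemma free_extend_single:
  assumes "a \<in> carrier R" "t x \<in> carrier M"
  shows "free_extend R M t (single R x a) = a \<odot>\<^bsub>M\<^esub> t x"
proof -
  have "free_extend R M t (single R x a) = finsum M (\<lambda>y. single R x a y \<odot>\<^bsub>M\<^esub> t y) {x}"
    using assms R.single_closed[of a x "{x}"] by (intro free_extend_eq[of _ "{x}"]) (auto simp: single_def)
  then show ?thesis
    using assms by (simp add: single_def M.finsum_insert M.finsum_empty)
qed

text \<open>Both sides are sums over the support of \<open>c\<close>, and \<open>f\<close> passes
  through the sum by additivity and through each term by linearity.\<close>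

lemma free_extend_natural:
  assumes "right_module R M'" and f: "f \<in> hom (add_monoid M) (add_monoid M')"
    and f_smult: "\<And>a x. \<lbrakk>a \<in> carrier R; x \<in> carrier M\<rbrakk> \<Longrightarrow> f (a \<odot>\<^bsub>M\<^esub> x) = a \<odot>\<^bsub>M'\<^esub> f x"
    and t: "t \<in> U \<rightarrow> carrier M" and c: "c \<in> carrier (free_right_module R U)"
  shows "f (free_extend R M t c) = free_extend R M' (\<lambda>x. f (t x)) c"
proof -
  interpret M': right_module R M' by fact
  have "f (free_extend R M t c) = finsum M' (\<lambda>x. f (c x \<odot>\<^bsub>M\<^esub> t x)) {x. c x \<noteq> \<zero>\<^bsub>R\<^esub>}"
    unfolding free_extend_def using c t f M.abelian_group_axioms M'.M.abelian_group_axioms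
    by (intro hom_finsum) (auto simp: free_right_module_simps Pi_iff subset_iff)
  also have "\<dots> = free_extend R M' (\<lambda>x. f (t x)) c"
    unfolding free_extend_def using c t f
    by (intro M'.M.finsum_cong') (auto simp: f_smult hom_def free_right_module_simps Pi_iff subset_iff)
  finally show ?thesis .
qed

lemma free_eval_closed:
  "\<lbrakk>U \<subseteq> carrier M; c \<in> carrier (free_right_module R U)\<rbrakk> \<Longrightarrow> free_eval R M c \<in> carrier M"
  unfolding free_eval_eq by (rule free_extend_closed) auto

text \<open>Consecutive maps of the standard resolution compose to zero: by naturality the composite
  is the extension of \<open>free_eval\<close> from basis elements in its own kernel, a sum of
  zeros.\<close>

lemma free_eval_free_eval:
  assumes c: "c \<in> carrier (free_right_module R
      (a_kernel (free_right_module R U) M (free_eval R M)))" and U: "U \<subseteq> carrier M"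
  shows "free_eval R M (free_eval R (free_right_module R U) c) = \<zero>\<^bsub>M\<^esub>"
proof -
  let ?F = "free_right_module R U"
  interpret F: right_module R ?F by (rule R.right_module_free)
  let ?K = "a_kernel ?F M (free_eval R M)"
  have K: "x \<in> carrier ?F" "free_eval R M x = \<zero>\<^bsub>M\<^esub>" if "x \<in> ?K" for x
    using that by (auto simp: a_kernel_def')
  have "free_eval R M (free_extend R ?F (\<lambda>x. x) c) = free_extend R M (free_eval R M) c"
    using free_extend_hom[of "\<lambda>x. x" U] free_extend_smult[of "\<lambda>x. x" U] U K(1) c
    by (intro F.free_extend_natural right_module_axioms) (auto simp: free_eval_eq)
  also have "\<dots> = \<zero>\<^bsub>M\<^esub>"
    unfolding free_extend_def using K(2) c
    by (intro M.add.finprod_one_eqI) (auto simp: free_right_module_simps subset_iff)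
  finally show ?thesis by (simp add: free_eval_eq)
qed

end

section \<open>Balanced relations\<close>

lemma balanced_relations_cases [consumes 1, case_names left right smult]:
  assumes "c \<in> balanced_relations A M N"
  obtains x x' y where "c = frag_of (x \<oplus>\<^bsub>M\<^esub> x', y) - frag_of (x, y) - frag_of (x', y)"
      "x \<in> carrier M" "x' \<in> carrier M" "y \<in> carrier N"
    | x y y' where "c = frag_of (x, y \<oplus>\<^bsub>N\<^esub> y') - frag_of (x, y) - frag_of (x, y')"
      "x \<in> carrier M" "y \<in> carrier N" "y' \<in> carrier N"
    | a x y where "c = frag_of (a \<odot>\<^bsub>M\<^esub> x, y) - frag_of (x, a \<odot>\<^bsub>N\<^esub> y)"
      "a \<in> carrier A" "x \<in> carrier M" "y \<in> carrier N"
  using assms unfolding balanced_relations_def by blast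

lemma balanced_relationsI:
  "\<lbrakk>x \<in> carrier M; x' \<in> carrier M; y \<in> carrier N\<rbrakk> \<Longrightarrow>
    frag_of (x \<oplus>\<^bsub>M\<^esub> x', y) - frag_of (x, y) - frag_of (x', y) \<in> balanced_relations A M N"
  "\<lbrakk>x \<in> carrier M; y \<in> carrier N; y' \<in> carrier N\<rbrakk> \<Longrightarrow>
    frag_of (x, y \<oplus>\<^bsub>N\<^esub> y') - frag_of (x, y) - frag_of (x, y') \<in> balanced_relations A M N"
  "\<lbrakk>a \<in> carrier A; x \<in> carrier M; y \<in> carrier N\<rbrakk> \<Longrightarrow>
    frag_of (a \<odot>\<^bsub>M\<^esub> x, y) - frag_of (x, a \<odot>\<^bsub>N\<^esub> y) \<in> balanced_relations A M N"
  unfolding balanced_relations_def by blast+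

locale balanced_pair = M: ring_action R M + N: ring_action R N
  for R (structure) and M :: "('a, 'm, 'k) module_scheme" and N :: "('a, 'n, 'l) module_scheme"
begin

lemma balanced_null_subgroup:
  "subgroup (balanced_null R M N) (free_Abelian_group (carrier M \<times> carrier N))"
proof -
  have "balanced_relations R M N \<subseteq> carrier (free_Abelian_group (carrier M \<times> carrier N))"
    by (auto simp: balanced_relations_def dest!: subsetD[OF keys_diff])
  then show ?thesis
    unfolding balanced_null_def by (intro group.generate_is_subgroup group_free_Abelian_group)
qed

lemma balanced_null_zero: "0 \<in> balanced_null R M N"
  using subgroup.one_closed[OF balanced_null_subgroup] by simp

lemma balanced_null_keys:
  "x \<in> balanced_null R M N \<Longrightarrow> Poly_Mapping.keys x \<subseteq> carrier M \<times> carrier N"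
  using subgroup.mem_carrier[OF balanced_null_subgroup] by simp

lemma balanced_null_add:
  "\<lbrakk>x \<in> balanced_null R M N; y \<in> balanced_null R M N\<rbrakk> \<Longrightarrow> x + y \<in> balanced_null R M N"
  using subgroup.m_closed[OF balanced_null_subgroup] by simp

lemma balanced_null_uminus: "x \<in> balanced_null R M N \<Longrightarrow> - x \<in> balanced_null R M N"
  using subgroup.m_inv_closed[OF balanced_null_subgroup] balanced_null_keys by fastforce

lemma balanced_null_coset:
  assumes "x \<in> balanced_null R M N"
  shows "balanced_null R M N #>\<^bsub>free_Abelian_group (carrier M \<times> carrier N)\<^esub> x = balanced_null R M N"
  using assms balanced_null_subgroup balanced_null_keys
  by (intro group.coset_join2) auto

end

section \<open>The kernel of a ring homomorphism and Tor of its image\<close>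

text \<open>The ring as a right module over itself, the target of \<open>lift\<close>.\<close>

definition regular_right :: "('a, 'k) ring_scheme \<Rightarrow> ('a, 'a) module" where
  "regular_right A =
     \<lparr>carrier = carrier A, monoid.mult = monoid.mult A, one = monoid.one A,
      ring.zero = ring.zero A, ring.add = ring.add A, smult = \<lambda>a x. x \<otimes>\<^bsub>A\<^esub> a\<rparr>"

lemma regular_right_simps [simp]:
  "carrier (regular_right A) = carrier A"
  "\<zero>\<^bsub>regular_right A\<^esub> = \<zero>\<^bsub>A\<^esub>"
  "x \<oplus>\<^bsub>regular_right A\<^esub> y = x \<oplus>\<^bsub>A\<^esub> y"
  "a \<odot>\<^bsub>regular_right A\<^esub> x = x \<otimes>\<^bsub>A\<^esub> a"
  by (simp_all add: regular_right_def)

lemma (in ring) right_module_regular: "right_module R (regular_right R)"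
proof (intro right_module.intro ring_action.intro right_module_axioms.intro ring_action_axioms.intro)
  show "ring R" by (rule ring_axioms)
  show "abelian_group (regular_right R)"
  proof (rule abelian_groupI)
    show "\<exists>y\<in>carrier (regular_right R). y \<oplus>\<^bsub>regular_right R\<^esub> x = \<zero>\<^bsub>regular_right R\<^esub>"
      if "x \<in> carrier (regular_right R)" for x
      using that by (intro bexI[of _ "\<ominus> x"]) (auto simp: l_neg)
  qed (auto simp: a_ac)
qed (auto simp: m_assoc l_distr r_distr)

text \<open>\<open>image_right\<close> and \<open>image_left\<close> are the constructions of
  \<open>R_right\<close> and \<open>R_left\<close> for an arbitrary homomorphism, so the argument on
  Tor can be made for any ring homomorphism.\<close>

definition image_right :: "('a, 'k) ring_scheme \<Rightarrow> 'b ring \<Rightarrow> ('a \<Rightarrow> 'b) \<Rightarrow> ('a, 'b) module" where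
  "image_right A E h =
     ring.extend (E\<lparr>carrier := h ` carrier A\<rparr>) (module.fields (\<lambda>a f. f \<otimes>\<^bsub>E\<^esub> h a))"

definition image_left :: "('a, 'k) ring_scheme \<Rightarrow> 'b ring \<Rightarrow> ('a \<Rightarrow> 'b) \<Rightarrow> ('a, 'b) module" where
  "image_left A E h =
     ring.extend (E\<lparr>carrier := h ` carrier A\<rparr>) (module.fields (\<lambda>a f. h a \<otimes>\<^bsub>E\<^esub> f))"

lemma image_module_simps [simp]:
  "carrier (image_right A E h) = h ` carrier A"
  "\<zero>\<^bsub>image_right A E h\<^esub> = \<zero>\<^bsub>E\<^esub>"
  "x \<oplus>\<^bsub>image_right A E h\<^esub> y = x \<oplus>\<^bsub>E\<^esub> y"
  "a \<odot>\<^bsub>image_right A E h\<^esub> x = x \<otimes>\<^bsub>E\<^esub> h a"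
  "\<zero>\<^bsub>image_left A E h\<^esub> = \<zero>\<^bsub>E\<^esub>"
  "x \<oplus>\<^bsub>image_left A E h\<^esub> y = x \<oplus>\<^bsub>E\<^esub> y"
  "a \<odot>\<^bsub>image_left A E h\<^esub> x = h a \<otimes>\<^bsub>E\<^esub> x"
  by (simp_all add: image_right_def image_left_def ring.defs module.defs)

lemma carrier_image_left: "carrier (image_left A E h) = h ` carrier A"
  by (simp add: image_left_def ring.defs)

section \<open>The standard resolution of the image of a ring homomorphism\<close>

locale ring_image = ring_hom_ring A E h
  for A :: "('a, 'k) ring_scheme" and E :: "'b ring" and h
begin

abbreviation "K \<equiv> a_kernel A E h"
abbreviation "M \<equiv> image_right A E h"
abbreviation "N \<equiv> image_left A E h"
abbreviation "F0 \<equiv> res0 A M"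
abbreviation "F1 \<equiv> res1 A M"
abbreviation "F2 \<equiv> res2 A M"

text \<open>Both module structures on the image share their addition, so one argument serves
  \<open>M\<close> and \<open>N\<close>.\<close>

lemma image_abelian_groupI:
  assumes "carrier G = h ` carrier A" "\<zero>\<^bsub>G\<^esub> = \<zero>\<^bsub>E\<^esub>" "\<And>x y. x \<oplus>\<^bsub>G\<^esub> y = x \<oplus>\<^bsub>E\<^esub> y"
  shows "abelian_group G"
proof (rule abelian_groupI)
  show "\<zero>\<^bsub>G\<^esub> \<in> carrier G"
    using hom_zero R.zero_closed unfolding assms by (metis imageI)
  show "x \<oplus>\<^bsub>G\<^esub> y \<in> carrier G" if "x \<in> carrier G" "y \<in> carrier G" for x y
    using that by (auto simp: assms simp flip: hom_add)
  show "\<exists>y\<in>carrier G. y \<oplus>\<^bsub>G\<^esub> x = \<zero>\<^bsub>G\<^esub>" if x: "x \<in> carrier G" for x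
  proof -
    obtain a where a: "a \<in> carrier A" "x = h a" using x by (auto simp: assms)
    then have "h (\<ominus>\<^bsub>A\<^esub> a) \<oplus>\<^bsub>E\<^esub> x = \<zero>\<^bsub>E\<^esub>" by (simp add: S.l_neg)
    then show ?thesis using a R.a_inv_closed unfolding assms by blast
  qed
qed (auto simp: assms S.a_ac)

sublocale M: right_module A M
proof (intro right_module.intro ring_action.intro right_module_axioms.intro ring_action_axioms.intro)
  show "ring A" by (rule R.ring_axioms)
  show "abelian_group M" by (rule image_abelian_groupI) auto
qed (auto simp: R.m_assoc S.l_distr S.r_distr simp flip: hom_mult)

sublocale N: ring_action A N
proof (intro ring_action.intro ring_action_axioms.intro)
  show "ring A" by (rule R.ring_axioms)
  show "abelian_group N" by (rule image_abelian_groupI) (auto simp: carrier_image_left)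
qed (auto simp: carrier_image_left simp flip: hom_mult)

sublocale F0: right_module A F0
  unfolding res0_def by (rule R.right_module_free)

sublocale F1: right_module A F1
  unfolding res1_def by (rule R.right_module_free)

sublocale F2: right_module A F2
  unfolding res2_def by (rule R.right_module_free)

sublocale T0: balanced_pair A F0 N ..
sublocale T1: balanced_pair A F1 N ..
sublocale T2: balanced_pair A F2 N ..

text \<open>The boundary from \<open>F1\<close> to \<open>F0\<close> is right linear and lands in
  the kernel of the evaluation to \<open>M\<close>, because the basis of \<open>F1\<close> consists
  of elements of that kernel.\<close>

lemma free_eval_F1:
  "w \<in> carrier F1 \<Longrightarrow> free_eval A F0 w \<in> carrier F0"
  "w \<in> carrier F1 \<Longrightarrow> free_eval A M (free_eval A F0 w) = \<zero>\<^bsub>E\<^esub>"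
  "\<lbrakk>w \<in> carrier F1; w' \<in> carrier F1\<rbrakk> \<Longrightarrow>
    free_eval A F0 (w \<oplus>\<^bsub>F1\<^esub> w') = free_eval A F0 w \<oplus>\<^bsub>F0\<^esub> free_eval A F0 w'"
  "\<lbrakk>a \<in> carrier A; w \<in> carrier F1\<rbrakk> \<Longrightarrow> free_eval A F0 (a \<odot>\<^bsub>F1\<^esub> w) = a \<odot>\<^bsub>F0\<^esub> free_eval A F0 w"
proof -
  let ?U = "a_kernel F0 M (free_eval A M)"
  have U: "?U \<subseteq> carrier F0" by (auto simp: a_kernel_def')
  show "free_eval A F0 w \<in> carrier F0" if "w \<in> carrier F1"
    using that by (intro F0.free_eval_closed[OF U]) (simp add: res1_def)
  show "free_eval A M (free_eval A F0 w) = \<zero>\<^bsub>E\<^esub>" if "w \<in> carrier F1"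
    using that M.free_eval_free_eval[of w "carrier M"] by (simp add: res1_def res0_def)
  show "free_eval A F0 (w \<oplus>\<^bsub>F1\<^esub> w') = free_eval A F0 w \<oplus>\<^bsub>F0\<^esub> free_eval A F0 w'"
    if "w \<in> carrier F1" "w' \<in> carrier F1"
    using that U unfolding free_eval_eq res1_def by (intro F0.free_extend_add) auto
  show "free_eval A F0 (a \<odot>\<^bsub>F1\<^esub> w) = a \<odot>\<^bsub>F0\<^esub> free_eval A F0 w"
    if "a \<in> carrier A" "w \<in> carrier F1"
    using that U unfolding free_eval_eq res1_def by (intro F0.free_extend_smult) auto
qed

lemma free_eval_F2:
  assumes "u \<in> carrier F2"
  shows "free_eval A F1 u \<in> carrier F1" "free_eval A F0 (free_eval A F1 u) = \<zero>\<^bsub>F0\<^esub>"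
proof -
  have "a_kernel F1 F0 (free_eval A F0) \<subseteq> carrier F1" by (auto simp: a_kernel_def')
  then show "free_eval A F1 u \<in> carrier F1"
    using assms by (intro F1.free_eval_closed) (auto simp: res2_def)
  show "free_eval A F0 (free_eval A F1 u) = \<zero>\<^bsub>F0\<^esub>"
    using assms F0.free_eval_free_eval[of u "a_kernel F0 M (free_eval A M)"]
    by (simp add: res2_def res1_def a_kernel_def')
qed

text \<open>
  A set-theoretic section of \<^term>\<open>h\<close>, normalised so that
  \<open>pairing\<close> below sends the class of the generator \<open>e \<otimes> 1\<close> to
  exactly \<open>k\<close>.
\<close>

definition sec :: "'b \<Rightarrow> 'a" where
  "sec x = (if x = \<one>\<^bsub>E\<^esub> then \<one>\<^bsub>A\<^esub> else SOME a. a \<in> carrier A \<and> h a = x)"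

lemma sec: "x \<in> h ` carrier A \<Longrightarrow> sec x \<in> carrier A \<and> h (sec x) = x"
proof -
  assume "x \<in> h ` carrier A"
  then have "\<exists>a. a \<in> carrier A \<and> h a = x" by auto
  from someI_ex[OF this] show ?thesis by (simp add: sec_def)
qed

lemma sec_closed: "x \<in> carrier N \<Longrightarrow> sec x \<in> carrier A"
  using sec by (simp add: carrier_image_left)

lemma sec_one: "sec \<one>\<^bsub>E\<^esub> = \<one>\<^bsub>A\<^esub>"
  by (simp add: sec_def)

text \<open>The map g of the overview. Although \<open>sec\<close> is only a map of sets, freeness
  of \<open>F0\<close> makes its extension linear.\<close>

definition lift :: "('b \<Rightarrow> 'a) \<Rightarrow> 'a" where
  "lift = free_extend A (regular_right A) sec"

lemma lift:
  "c \<in> carrier F0 \<Longrightarrow> lift c \<in> carrier A"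
  "c \<in> carrier F0 \<Longrightarrow> h (lift c) = free_eval A M c"
  "\<lbrakk>c \<in> carrier F0; d \<in> carrier F0\<rbrakk> \<Longrightarrow> lift (c \<oplus>\<^bsub>F0\<^esub> d) = lift c \<oplus>\<^bsub>A\<^esub> lift d"
  "\<lbrakk>a \<in> carrier A; c \<in> carrier F0\<rbrakk> \<Longrightarrow> lift (a \<odot>\<^bsub>F0\<^esub> c) = lift c \<otimes>\<^bsub>A\<^esub> a"
  "lift \<zero>\<^bsub>F0\<^esub> = \<zero>\<^bsub>A\<^esub>"
  "a \<in> carrier A \<Longrightarrow> lift (single A \<one>\<^bsub>E\<^esub> a) = a"
proof -
  interpret G: right_module A "regular_right A" by (rule R.right_module_regular)
  have t: "sec \<in> carrier M \<rightarrow> carrier (regular_right A)" using sec by auto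
  show "lift c \<in> carrier A" if "c \<in> carrier F0"
    using G.free_extend_closed[OF t] that by (simp add: lift_def res0_def)
  show "lift (c \<oplus>\<^bsub>F0\<^esub> d) = lift c \<oplus>\<^bsub>A\<^esub> lift d" if "c \<in> carrier F0" "d \<in> carrier F0"
    using G.free_extend_add[OF t] that by (simp add: lift_def res0_def)
  show "lift (a \<odot>\<^bsub>F0\<^esub> c) = lift c \<otimes>\<^bsub>A\<^esub> a" if "a \<in> carrier A" "c \<in> carrier F0"
    using G.free_extend_smult[OF t] that by (simp add: lift_def res0_def)
  show "lift \<zero>\<^bsub>F0\<^esub> = \<zero>\<^bsub>A\<^esub>"
    using G.free_extend_zero by (simp add: lift_def res0_def free_right_module_simps)
  show "lift (single A \<one>\<^bsub>E\<^esub> a) = a" if "a \<in> carrier A"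
    using that by (simp add: lift_def G.free_extend_single sec_one)
  show "h (lift c) = free_eval A M c" if c: "c \<in> carrier F0"
  proof -
    \<comment> \<open>Naturality applies to \<open>h\<close> as a homomorphism of right modules from
      the ring to \<open>M\<close>; on basis elements \<open>h (sec x) = x\<close>.\<close>
    have "h (lift c) = free_extend A M (\<lambda>x. h (sec x)) c"
      unfolding lift_def using t c
      by (intro G.free_extend_natural[OF M.right_module_axioms]) (auto simp: hom_def res0_def)
    also have "\<dots> = free_eval A M c"
      unfolding free_extend_def free_eval_def using c sec
      by (intro M.M.finsum_cong') (auto simp: res0_def free_right_module_simps subset_iff simp flip: hom_mult)
    finally show ?thesis .
  qed
qed

text \<open>The composite of g with the boundary from \<open>F1\<close> to
  \<open>F0\<close>.\<close>

definition weight :: "(('b \<Rightarrow> 'a) \<Rightarrow> 'a) \<Rightarrow> 'a" where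
  "weight w = lift (free_eval A F0 w)"

lemma mem_K_iff: "x \<in> K \<longleftrightarrow> x \<in> carrier A \<and> h x = \<zero>\<^bsub>E\<^esub>"
  unfolding a_kernel_def' by blast

text \<open>Applying \<open>h\<close> after \<open>lift\<close> gives the evaluation to
  \<open>M\<close>, which kills boundaries from \<open>F1\<close>; hence the values in
  \<open>K\<close>. On the image of \<open>F2\<close> the boundary itself vanishes.\<close>

lemma weight:
  "w \<in> carrier F1 \<Longrightarrow> weight w \<in> K"
  "w \<in> carrier F1 \<Longrightarrow> weight w \<in> carrier A"
  "\<lbrakk>w \<in> carrier F1; w' \<in> carrier F1\<rbrakk> \<Longrightarrow> weight (w \<oplus>\<^bsub>F1\<^esub> w') = weight w \<oplus>\<^bsub>A\<^esub> weight w'"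
  "\<lbrakk>a \<in> carrier A; w \<in> carrier F1\<rbrakk> \<Longrightarrow> weight (a \<odot>\<^bsub>F1\<^esub> w) = weight w \<otimes>\<^bsub>A\<^esub> a"
  "u \<in> carrier F2 \<Longrightarrow> weight (free_eval A F1 u) = \<zero>\<^bsub>A\<^esub>"
  by (simp_all add: weight_def mem_K_iff free_eval_F1 free_eval_F2 lift)

text \<open>
  Modulo the square of the kernel, \<open>pairing\<close> factors through the tensor product over
  \<open>A\<close>: a change of \<^term>\<open>sec y\<close> lies in the kernel and is multiplied by a
  weight, which also lies in the kernel.
\<close>

definition pairing :: "((('b \<Rightarrow> 'a) \<Rightarrow> 'a) \<times> 'b \<Rightarrow>\<^sub>0 int) \<Rightarrow> 'a" where
  "pairing = (SOME f. f \<in> hom (free_Abelian_group (carrier F1 \<times> carrier N)) (add_monoid A) \<and>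
     (\<forall>w\<in>carrier F1. \<forall>y\<in>carrier N. f (frag_of (w, y)) = weight w \<otimes>\<^bsub>A\<^esub> sec y))"

text \<open>The choice exists by the universal property of the free abelian group.\<close>

lemma pairing:
  "pairing \<in> hom (free_Abelian_group (carrier F1 \<times> carrier N)) (add_monoid A)"
  "\<lbrakk>w \<in> carrier F1; y \<in> carrier N\<rbrakk> \<Longrightarrow> pairing (frag_of (w, y)) = weight w \<otimes>\<^bsub>A\<^esub> sec y"
proof -
  obtain f where "f \<in> hom (free_Abelian_group (carrier F1 \<times> carrier N)) (add_monoid A)"
    "\<And>p. p \<in> carrier F1 \<times> carrier N \<Longrightarrow> f (frag_of p) = (case p of (w, y) \<Rightarrow> weight w \<otimes>\<^bsub>A\<^esub> sec y)"
    using comm_group.free_Abelian_group_universal[OF R.a_comm_group,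
        of "\<lambda>(w, y). weight w \<otimes>\<^bsub>A\<^esub> sec y" "carrier F1 \<times> carrier N"] weight(2) sec
    by (auto simp: image_subset_iff carrier_image_left)
  then have "\<exists>f. f \<in> hom (free_Abelian_group (carrier F1 \<times> carrier N)) (add_monoid A) \<and>
     (\<forall>w\<in>carrier F1. \<forall>y\<in>carrier N. f (frag_of (w, y)) = weight w \<otimes>\<^bsub>A\<^esub> sec y)" by auto
  from someI_ex[OF this] show
    "pairing \<in> hom (free_Abelian_group (carrier F1 \<times> carrier N)) (add_monoid A)"
    "\<lbrakk>w \<in> carrier F1; y \<in> carrier N\<rbrakk> \<Longrightarrow> pairing (frag_of (w, y)) = weight w \<otimes>\<^bsub>A\<^esub> sec y"
    unfolding pairing_def by auto
qed

sublocale pairing: group_hom "free_Abelian_group (carrier F1 \<times> carrier N)" "add_monoid A" pairing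
  using pairing(1) R.a_group by (intro group_hom.intro group_hom_axioms.intro) auto

text \<open>Membership in the free abelian group on pairs from \<open>F1\<close> and
  \<open>N\<close>, the domain on which \<open>pairing\<close> is known to be additive.\<close>

abbreviation "T1_keys c \<equiv> Poly_Mapping.keys c \<subseteq> carrier F1 \<times> carrier N"

lemma pairing_add:
  "\<lbrakk>T1_keys c; T1_keys d\<rbrakk> \<Longrightarrow> pairing (c + d) = pairing c \<oplus>\<^bsub>A\<^esub> pairing d"
  using pairing.hom_mult[of c d] by simp

lemma pairing_uminus: "T1_keys c \<Longrightarrow> pairing (- c) = \<ominus>\<^bsub>A\<^esub> pairing c"
  using pairing.hom_inv[of c] by (simp add: a_inv_def)

lemma pairing_diff:
  "\<lbrakk>T1_keys c; T1_keys d\<rbrakk> \<Longrightarrow> pairing (c - d) = pairing c \<ominus>\<^bsub>A\<^esub> pairing d"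
  using pairing_add[of c "- d"] pairing_uminus[of d] by (simp add: a_minus_def)

lemma pairing_zero: "pairing 0 = \<zero>\<^bsub>A\<^esub>"
  using pairing.hom_one by simp

lemma ideal_K: "ideal K A"
  by (rule kernel_is_ideal)

lemma ideal_K2: "ideal (K \<cdot>\<^bsub>A\<^esub> K) A"
  by (rule R.ideal_prod_is_ideal) (rule ideal_K)+

sublocale K2: ideal "K \<cdot>\<^bsub>A\<^esub> K" A
  by (rule ideal_K2)

lemma T1_keys_diff: "T1_keys c \<Longrightarrow> T1_keys d \<Longrightarrow> T1_keys (c - d)"
  using keys_diff[of c d] by blast

text \<open>Relations in the first slot go exactly to zero, as \<open>weight\<close> is additive. In
  the other two families the failure of \<open>sec\<close> to respect sums or the action is killed
  by \<open>h\<close>, hence lies in \<open>K\<close>, and it is multiplied by a weight.\<close>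

lemma pairing_relations:
  assumes "c \<in> balanced_relations A F1 N"
  shows "T1_keys c \<and> pairing c \<in> K \<cdot>\<^bsub>A\<^esub> K"
proof -
  from assms show ?thesis
  proof (cases rule: balanced_relations_cases)
    case (left w w' y)
    have y: "sec y \<in> carrier A" using left sec by (auto simp: carrier_image_left)
    have keys: "T1_keys (frag_of (w \<oplus>\<^bsub>F1\<^esub> w', y))" "T1_keys (frag_of (w, y))" "T1_keys (frag_of (w', y))"
      using left by auto
    have "pairing c = (weight w \<oplus>\<^bsub>A\<^esub> weight w') \<otimes>\<^bsub>A\<^esub> sec y
        \<ominus>\<^bsub>A\<^esub> weight w \<otimes>\<^bsub>A\<^esub> sec y \<ominus>\<^bsub>A\<^esub> weight w' \<otimes>\<^bsub>A\<^esub> sec y"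
      using left(2-4) keys by (simp add: left(1) pairing_diff T1_keys_diff pairing(2) weight(3))
    also have "\<dots> = \<zero>\<^bsub>A\<^esub>"
      using left y weight(2) by (simp add: R.l_distr a_minus_def) (simp add: R.a_ac R.r_neg R.r_neg1 R.r_neg2)
    finally show ?thesis
      using keys by (simp add: left(1) T1_keys_diff)
  next
    case (right w y y')
    have y: "sec y \<in> carrier A" "sec y' \<in> carrier A" "sec (y \<oplus>\<^bsub>E\<^esub> y') \<in> carrier A"
      "h (sec y) = y" "h (sec y') = y'" "h (sec (y \<oplus>\<^bsub>E\<^esub> y')) = y \<oplus>\<^bsub>E\<^esub> y'"
      using right sec N.M.a_closed[of y y'] by (auto simp: carrier_image_left)
    have yE: "y \<in> carrier E" "y' \<in> carrier E" using right by (auto simp: carrier_image_left)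
    let ?d = "sec (y \<oplus>\<^bsub>E\<^esub> y') \<ominus>\<^bsub>A\<^esub> sec y \<ominus>\<^bsub>A\<^esub> sec y'"
    have "?d \<in> K"
      using y yE by (simp add: mem_K_iff a_minus_def) (simp add: S.a_ac S.r_neg S.r_neg1 S.r_neg2)
    then have "weight w \<otimes>\<^bsub>A\<^esub> ?d \<in> K \<cdot>\<^bsub>A\<^esub> K"
      using weight(1) right by (intro ideal_prod.prod) auto
    moreover have keys: "T1_keys (frag_of (w, y \<oplus>\<^bsub>N\<^esub> y'))" "T1_keys (frag_of (w, y))" "T1_keys (frag_of (w, y'))"
      using right N.M.a_closed[of y y'] by auto
    moreover have "pairing c = weight w \<otimes>\<^bsub>A\<^esub> ?d"
      using right(2-4) keys y weight(2) N.M.a_closed[of y y']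
      by (simp add: right(1) pairing_diff T1_keys_diff pairing(2) a_minus_def R.r_distr R.r_minus)
    ultimately show ?thesis
      by (simp add: right(1) T1_keys_diff)
  next
    case (smult a w y)
    have y: "sec y \<in> carrier A" "sec (h a \<otimes>\<^bsub>E\<^esub> y) \<in> carrier A"
      "h (sec y) = y" "h (sec (h a \<otimes>\<^bsub>E\<^esub> y)) = h a \<otimes>\<^bsub>E\<^esub> y"
      using smult sec N.smult_closed[of a y] by (auto simp: carrier_image_left)
    have yE: "y \<in> carrier E" using smult by (auto simp: carrier_image_left)
    \<comment> \<open>\<open>weight\<close> turns the action of \<open>a\<close> on \<open>w\<close>
      into right multiplication by \<open>a\<close>, which then stands in front of
      \<open>sec y\<close>.\<close>
    let ?d = "a \<otimes>\<^bsub>A\<^esub> sec y \<ominus>\<^bsub>A\<^esub> sec (h a \<otimes>\<^bsub>E\<^esub> y)"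
    have "?d \<in> K"
      using y yE smult by (simp add: mem_K_iff a_minus_def S.r_neg)
    then have "weight w \<otimes>\<^bsub>A\<^esub> ?d \<in> K \<cdot>\<^bsub>A\<^esub> K"
      using weight(1) smult by (intro ideal_prod.prod) auto
    moreover have keys: "T1_keys (frag_of (a \<odot>\<^bsub>F1\<^esub> w, y))" "T1_keys (frag_of (w, a \<odot>\<^bsub>N\<^esub> y))"
      using smult N.smult_closed[of a y] by auto
    moreover have "pairing c = weight w \<otimes>\<^bsub>A\<^esub> ?d"
      using smult(2-4) keys y weight(2) N.smult_closed[of a y]
      by (simp add: smult(1) pairing_diff T1_keys_diff pairing(2) weight(4) a_minus_def R.r_distr R.r_minus R.m_assoc)
    ultimately show ?thesis
      by (simp add: smult(1) T1_keys_diff)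
  qed
qed

lemma pairing_null:
  assumes "c \<in> balanced_null A F1 N"
  shows "pairing c \<in> K \<cdot>\<^bsub>A\<^esub> K"
proof -
  have "T1_keys c \<and> pairing c \<in> K \<cdot>\<^bsub>A\<^esub> K"
    using assms unfolding balanced_null_def
  proof (induction rule: generate.induct)
    case one
    then show ?case by (simp add: pairing_zero)
  next
    case (incl c)
    then show ?case by (rule pairing_relations)
  next
    case (inv c)
    from pairing_relations[OF this] show ?case
      by (simp add: pairing_uminus)
  next
    case (eng c d)
    then show ?case
      using keys_add[of c d] by (auto simp: pairing_add intro: K2.a_closed)
  qed
  then show ?thesis by simp
qed

text \<open>A representative has the form n + f d with n null. \<open>pairing_null\<close> handles
  n, while f d itself goes to zero because weights kill the image of \<open>F2\<close>.\<close>

lemma pairing_boundary: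
  assumes U: "U \<in> carrier (tensor_prod A F2 N)"
    and c: "c \<in> tensor_map A F1 N (free_eval A F1) U"
  shows "T1_keys c \<and> pairing c \<in> K \<cdot>\<^bsub>A\<^esub> K"
proof -
  let ?f = "frag_extend (\<lambda>(x, y). frag_of (free_eval A F1 x, y))"
  obtain n d where n: "n \<in> balanced_null A F1 N" and d: "d \<in> U" and c_eq: "c = n + ?f d"
    using c by (auto simp: tensor_map_def r_coset_def)
  \<comment> \<open>The induction on \<open>d\<close> needs its support; every member of a class is
    suitably supported, since null elements are.\<close>
  have "Poly_Mapping.keys d \<subseteq> carrier F2 \<times> carrier N"
  proof -
    obtain m d' where "m \<in> balanced_null A F2 N" "d = m + d'"
      "Poly_Mapping.keys d' \<subseteq> carrier F2 \<times> carrier N"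
      using U d unfolding tensor_prod_def carrier_FactGroup r_coset_def by auto
    then show ?thesis
      using T2.balanced_null_keys[of m] keys_add[of m d'] by auto
  qed
  then have "T1_keys (?f d) \<and> pairing (?f d) = \<zero>\<^bsub>A\<^esub>"
  proof (induction d rule: frag_induction)
    case (one p)
    then show ?case
      by (cases p) (auto simp: sec_closed pairing(2) weight(5) free_eval_F2)
  next
    case (diff a b)
    then have keys: "T1_keys (?f a)" "T1_keys (?f b)" by blast+
    show ?case
      using T1_keys_diff[OF keys] pairing_diff[OF keys] diff
      by (simp add: frag_extend_diff a_minus_def)
  qed (simp add: pairing_zero)
  then show ?thesis
    using n T1.balanced_null_keys[OF n] keys_add[of n "?f d"] pairing_null[OF n]
    by (auto simp: c_eq pairing_add)
qed

text \<open>This makes the boundary well defined after tensoring with \<open>N\<close>: a right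
  linear map sends each balanced relation to one of the same type.\<close>

lemma frag_extend_null:
  assumes "c \<in> balanced_null A F1 N"
  shows "frag_extend (\<lambda>(x, y). frag_of (free_eval A F0 x, y)) c \<in> balanced_null A F0 N"
  using assms unfolding balanced_null_def[of A F1 N]
proof (induction rule: generate.induct)
  let ?f = "frag_extend (\<lambda>(x, y). frag_of (free_eval A F0 x, y))"
  have rel: "?f c \<in> balanced_null A F0 N" if "c \<in> balanced_relations A F1 N" for c
    unfolding balanced_null_def using that
    by (cases rule: balanced_relations_cases)
       (auto simp: frag_extend_diff free_eval_F1 simp del: image_module_simps
         intro!: generate.incl intro: balanced_relationsI)
  {
    case one
    then show ?case by (simp add: T0.balanced_null_zero)
  next
    case (incl c)
    then show ?case by (rule rel)
  next
    case (inv c)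
    then show ?case
      \<comment> \<open>\<open>pairing_relations\<close> supplies the support of \<open>c\<close>,
        by which the group inverse is \<open>- c\<close>.\<close>
      using T0.balanced_null_uminus[OF rel] pairing_relations by (simp add: frag_extend_minus)
  next
    case (eng c d)
    then show ?case by (simp add: frag_extend_add T0.balanced_null_add)
  }
qed

section \<open>The cycle attached to an element of the kernel\<close>

lemma Tor1_trivial_imp_kernel_idempotent:
  assumes trivial: "carrier (Tor1 A M N) = {\<one>\<^bsub>Tor1 A M N\<^esub>}"
  shows "K \<subseteq> K \<cdot>\<^bsub>A\<^esub> K"
proof
  fix k assume k: "k \<in> K"
  then have kA: "k \<in> carrier A" and hk: "h k = \<zero>\<^bsub>E\<^esub>" by (simp_all add: mem_K_iff)
  let ?G1 = "tensor_prod A F1 N" and ?G0 = "tensor_prod A F0 N"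
  let ?d2 = "tensor_map A F1 N (free_eval A F1)" and ?d1 = "tensor_map A F0 N (free_eval A F0)"
  let ?B = "?d2 ` carrier (tensor_prod A F2 N)"
  have oneN: "\<one>\<^bsub>E\<^esub> \<in> carrier N" using R.one_closed hom_one by (metis image_eqI carrier_image_left)
  have oneM: "\<one>\<^bsub>E\<^esub> \<in> carrier M" using oneN by (simp add: carrier_image_left)
  \<comment> \<open>In the notation of the overview, \<open>z\<close> is [1] k.\<close>
  define z where "z = single A \<one>\<^bsub>E\<^esub> k"
  have z: "z \<in> carrier F0" unfolding z_def res0_def using kA oneM by (rule R.single_closed)
  have z_ker: "z \<in> a_kernel F0 M (free_eval A M)"
  proof -
    have "free_eval A M z = \<zero>\<^bsub>M\<^esub>"
      using kA oneM hk by (simp add: z_def free_eval_eq M.free_extend_single)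
    with z show ?thesis unfolding a_kernel_def' by blast
  qed
  \<comment> \<open>The basis element of \<open>F1\<close> at \<open>z\<close>; its boundary is
    \<open>z\<close>.\<close>
  define e where "e = single A z \<one>\<^bsub>A\<^esub>"
  have e: "e \<in> carrier F1" unfolding e_def res1_def using z_ker by (intro R.single_closed) auto
  have eval_e: "free_eval A F0 e = z"
    unfolding e_def free_eval_eq using z by (simp add: F0.free_extend_single)
  define U where "U = balanced_null A F1 N #>\<^bsub>free_Abelian_group (carrier F1 \<times> carrier N)\<^esub> frag_of (e, \<one>\<^bsub>E\<^esub>)"
  have frag_e: "T1_keys (frag_of (e, \<one>\<^bsub>E\<^esub>))" using e oneN by simp
  \<comment> \<open>\<open>tensor_map\<close> is a union over the representatives in
    \<open>U\<close>. Each is sent to a null element and so contributes the null subgroup itself,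
    and \<open>U\<close> is nonempty.\<close>
  have "?d1 U = balanced_null A F0 N"
  proof -
    let ?f = "frag_extend (\<lambda>(x, y). frag_of (free_eval A F0 x, y))"
    have zero: "frag_of (z, \<one>\<^bsub>E\<^esub>) \<in> balanced_null A F0 N"
    proof -
      \<comment> \<open>\<open>x\<close> is [1], and \<open>z\<close> is \<open>x\<close> acted on
        by \<open>k\<close>. Moving \<open>k\<close> across the tensor turns z \<otimes> 1 into x
        \<otimes> h k = x \<otimes> 0.\<close>
      define x where "x = single A \<one>\<^bsub>E\<^esub> \<one>\<^bsub>A\<^esub>"
      have x: "x \<in> carrier F0" unfolding x_def res0_def using oneM by (intro R.single_closed) auto
      have "k \<odot>\<^bsub>F0\<^esub> x = z"
        using kA by (auto simp: res0_def free_right_module_simps x_def z_def single_def)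
      moreover have "k \<odot>\<^bsub>N\<^esub> \<one>\<^bsub>E\<^esub> = \<zero>\<^bsub>E\<^esub>" by (simp add: hk)
      moreover have "frag_of (k \<odot>\<^bsub>F0\<^esub> x, \<one>\<^bsub>E\<^esub>) - frag_of (x, k \<odot>\<^bsub>N\<^esub> \<one>\<^bsub>E\<^esub>) \<in> balanced_null A F0 N"
        unfolding balanced_null_def by (intro generate.incl balanced_relationsI x kA oneN)
      ultimately have 1: "frag_of (z, \<one>\<^bsub>E\<^esub>) - frag_of (x, \<zero>\<^bsub>E\<^esub>) \<in> balanced_null A F0 N"
        by simp
      \<comment> \<open>The relation for 0 + 0 = 0 collapses to minus the generator x \<otimes> 0,
        which is therefore null.\<close>
      have "frag_of (x, \<zero>\<^bsub>N\<^esub> \<oplus>\<^bsub>N\<^esub> \<zero>\<^bsub>N\<^esub>) - frag_of (x, \<zero>\<^bsub>N\<^esub>) - frag_of (x, \<zero>\<^bsub>N\<^esub>) \<in> balanced_null A F0 N"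
        unfolding balanced_null_def by (intro generate.incl balanced_relationsI x N.M.zero_closed)
      then have "- frag_of (x, \<zero>\<^bsub>E\<^esub>) \<in> balanced_null A F0 N" by simp
      then have "frag_of (x, \<zero>\<^bsub>E\<^esub>) \<in> balanced_null A F0 N"
        using T0.balanced_null_uminus by fastforce
      with 1 show ?thesis
        using T0.balanced_null_add by fastforce
    qed
    have "?f c \<in> balanced_null A F0 N" if "c \<in> U" for c
      using that frag_extend_null zero
      by (auto simp: U_def r_coset_def frag_extend_add eval_e intro!: T0.balanced_null_add)
    moreover have "frag_of (e, \<one>\<^bsub>E\<^esub>) \<in> U"
      using T1.balanced_null_zero by (force simp: U_def r_coset_def)
    ultimately show ?thesis
      unfolding tensor_map_def using T0.balanced_null_coset by auto
  qed
  moreover have "U \<in> carrier ?G1"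
    using frag_e by (auto simp: tensor_prod_def carrier_FactGroup U_def)
  ultimately have "U \<in> kernel ?G1 ?G0 ?d1"
    by (simp add: kernel_def tensor_prod_def)
  then have "?B #>\<^bsub>?G1\<lparr>carrier := kernel ?G1 ?G0 ?d1\<rparr>\<^esub> U \<in> carrier (Tor1 A M N)"
    by (auto simp: Tor1_def Let_def carrier_FactGroup)
  \<comment> \<open>The neutral element of \<open>Tor1\<close> is the set \<open>?B\<close> of
    boundaries.\<close>
  then have coset: "?B #>\<^bsub>?G1\<lparr>carrier := kernel ?G1 ?G0 ?d1\<rparr>\<^esub> U = ?B"
    unfolding trivial by (simp add: Tor1_def Let_def)
  \<comment> \<open>\<open>D\<close> is a boundary class containing 0, the image of the neutral
    class over \<open>F2\<close>. By \<open>coset\<close> the sum of \<open>D\<close> and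
    \<open>U\<close> is again in \<open>?B\<close>, and it contains the representative e \<otimes>
    1.\<close>
  define D where "D = ?d2 (balanced_null A F2 N)"
  have null2: "balanced_null A F2 N \<in> carrier (tensor_prod A F2 N)"
    using T2.balanced_null_coset[OF T2.balanced_null_zero]
    by (force simp: tensor_prod_def carrier_FactGroup)
  have D0: "0 \<in> D"
    unfolding D_def tensor_map_def using T2.balanced_null_zero T1.balanced_null_zero
    by (force simp: r_coset_def)
  have "D <#>\<^bsub>free_Abelian_group (carrier F1 \<times> carrier N)\<^esub> U \<in> ?B"
    using coset null2 unfolding D_def r_coset_def by (auto simp: tensor_prod_def)
  moreover have "frag_of (e, \<one>\<^bsub>E\<^esub>) \<in> D <#>\<^bsub>free_Abelian_group (carrier F1 \<times> carrier N)\<^esub> U"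
    using D0 T1.balanced_null_zero by (force simp: set_mult_def U_def r_coset_def)
  ultimately have "pairing (frag_of (e, \<one>\<^bsub>E\<^esub>)) \<in> K \<cdot>\<^bsub>A\<^esub> K"
    using pairing_boundary by blast
  \<comment> \<open>\<open>sec_one\<close> enters twice: \<open>lift\<close> sends \<open>z\<close>
    to \<open>k\<close>, and the second slot contributes the factor 1.\<close>
  moreover have "pairing (frag_of (e, \<one>\<^bsub>E\<^esub>)) = k"
    using e oneN kA by (simp add: pairing(2) weight_def eval_e z_def lift sec_one)
  ultimately show "k \<in> K \<cdot>\<^bsub>A\<^esub> K" by simp
qed

end

section \<open>Nilpotent ideals and the theorem\<close>

text \<open>The unit gives the nontrivial inclusion. As \<open>ideal_power\<close> starts at
  exponent 0 with the whole ring, this identifies the first power with \<open>I\<close>.\<close>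

lemma (in ring) carrier_ideal_prod:
  assumes I: "ideal I R"
  shows "carrier R \<cdot> I = I"
proof
  show "carrier R \<cdot> I \<subseteq> I"
    using ideal_prod_inter[OF oneideal I] by blast
  show "I \<subseteq> carrier R \<cdot> I"
  proof
    fix x assume "x \<in> I"
    then show "x \<in> carrier R \<cdot> I"
      using ideal_prod.prod[of \<one> "carrier R" x I R] ideal.Icarr[OF I] by simp
  qed
qed

text \<open>An idempotent ideal equals each of its positive powers, one of which is zero.\<close>

lemma (in ring) nilpotent_idempotent_imp_zero:
  assumes I: "ideal I R" and nil: "nilpotent_ideal R I" and idem: "I \<subseteq> I \<cdot> I"
  shows "I = {\<zero>}"
proof -
  have "I \<cdot> I = I"
    using ideal_prod_inter[OF I I] idem by blast
  then have power: "ideal_power R I (Suc n) = I" for n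
    by (induction n) (simp_all add: carrier_ideal_prod[OF I])
  obtain N where "N \<ge> 1" "ideal_power R I N = {\<zero>}"
    using nil by (auto simp: nilpotent_ideal_def)
  \<comment> \<open>\<open>N \<ge> 1\<close> makes \<open>N\<close> the successor of
    \<open>N - 1\<close>; the zeroth power would be the whole ring.\<close>
  then show ?thesis
    using power[of "N - 1"] by simp
qed

theorem theorem9p3:
  fixes tern :: "'t::ab_group_add \<Rightarrow> 'g::ab_group_add \<Rightarrow> 't \<Rightarrow> 'g \<Rightarrow> 't \<Rightarrow> 't"
  assumes "ternary_gamma_ring tern"
    and "nilpotent_ideal (A_ring tern) (defect tern)"
  shows "(carrier (conormal_defect tern) = {\<one>\<^bsub>conormal_defect tern\<^esub>} \<longleftrightarrow>
            defect tern = {\<zero>\<^bsub>A_ring tern\<^esub>})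
       \<and> (defect tern = {\<zero>\<^bsub>A_ring tern\<^esub>} \<longleftrightarrow>
            inj_on (rho_hat tern) (carrier (A_ring tern)))
       \<and> (defect tern \<noteq> {\<zero>\<^bsub>A_ring tern\<^esub>} \<longrightarrow>
            carrier (Tor1 (A_ring tern) (R_right tern) (R_left tern)) \<noteq>
              {\<one>\<^bsub>Tor1 (A_ring tern) (R_right tern) (R_left tern)\<^esub>})"
proof -
  interpret ternary_gamma_ring tern by fact
  let ?A = "A_ring tern" and ?K = "defect tern"
  interpret ring_image ?A End_ring "rho_hat tern"
    using ring_A ring_End rho_hat_ring_hom
    by (intro ring_image.intro ring_hom_ring.intro ring_hom_ring_axioms.intro)
  have K: "ideal ?K ?A"
    using kernel_is_ideal by (simp add: defect_def)
  have K2: "ideal_power ?A ?K 2 = ?K \<cdot>\<^bsub>?A\<^esub> ?K"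
    by (simp add: numeral_2_eq_2 R.carrier_ideal_prod[OF K])
  let ?Q = "?K \<cdot>\<^bsub>?A\<^esub> ?K"
  \<comment> \<open>Triviality of the conormal defect and of \<open>Tor1\<close> both enter through
    the inclusion of \<open>?K\<close> in \<open>?Q\<close>.\<close>
  have zero_iff: "?K = {\<zero>\<^bsub>?A\<^esub>}" if "?K \<subseteq> ?Q"
    using R.nilpotent_idempotent_imp_zero[OF K assms(2) that] .
  \<comment> \<open>The elements of the quotient are the additive cosets of \<open>?Q\<close> by
    members of \<open>?K\<close>, with \<open>?Q\<close> itself neutral.\<close>
  have conormal: "carrier (conormal_defect tern) = (\<lambda>x. ?Q +>\<^bsub>?A\<^esub> x) ` ?K"
    "\<one>\<^bsub>conormal_defect tern\<^esub> = ?Q"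
    by (auto simp: conormal_defect_def carrier_FactGroup K2 a_r_coset_def r_coset_def)
  interpret Q: ideal ?Q ?A
    using ideal_K2 by (simp add: defect_def)
  interpret K: ideal ?K ?A by (rule K)
  have "carrier (conormal_defect tern) = {\<one>\<^bsub>conormal_defect tern\<^esub>} \<longleftrightarrow> ?K = {\<zero>\<^bsub>?A\<^esub>}"
  proof
    assume *: "carrier (conormal_defect tern) = {\<one>\<^bsub>conormal_defect tern\<^esub>}"
    show "?K = {\<zero>\<^bsub>?A\<^esub>}"
    proof (rule zero_iff, rule subsetI)
      fix x assume x: "x \<in> ?K"
      then have "?Q +>\<^bsub>?A\<^esub> x = ?Q" using * unfolding conormal by blast
      then show "x \<in> ?Q"
        using Q.a_rcos_self[of x] K.Icarr[OF x] by simp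
    qed
  next
    assume "?K = {\<zero>\<^bsub>?A\<^esub>}"
    then have "carrier (conormal_defect tern) = {?Q +>\<^bsub>?A\<^esub> \<zero>\<^bsub>?A\<^esub>}"
      unfolding conormal by simp
    then show "carrier (conormal_defect tern) = {\<one>\<^bsub>conormal_defect tern\<^esub>}"
      using Q.a_subset by (simp add: conormal(2))
  qed
  moreover have "?K = {\<zero>\<^bsub>?A\<^esub>} \<longleftrightarrow> inj_on (rho_hat tern) (carrier ?A)"
    using a_group_hom group_hom.inj_iff_trivial_ker[OF a_group_hom]
    by (simp add: defect_def a_kernel_def)
  \<comment> \<open>The contrapositive of the claim on \<open>Tor1\<close>; unfolded,
    \<open>R_right\<close> and \<open>R_left\<close> are the two image modules.\<close>
  moreover have "?K = {\<zero>\<^bsub>?A\<^esub>}"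
    if "carrier (Tor1 ?A (R_right tern) (R_left tern)) = {\<one>\<^bsub>Tor1 ?A (R_right tern) (R_left tern)\<^esub>}"
    using that Tor1_trivial_imp_kernel_idempotent zero_iff
    by (simp add: R_right_def R_left_def image_right_def image_left_def defect_def)
  ultimately show ?thesis by blast
qed

end
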